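(* Let $V=\mathbb C^d$. Any state $\varphi$ on $\mathcal P=\mathbb C[X_1,\dots,X_d]$ uniquely defines a pair $(\tilde\Omega^{\widehat\otimes},(a^0_{j|n}))$ that induces a $3$-diagonal structure on $\Gamma(V,\tilde\Omega^{\widehat\otimes})$. Conversely, any pair $(\tilde\Omega^{\widehat\otimes},(a^0_{j|n}))$ that induces a $3$-diagonal structure on $\Gamma(V,\tilde\Omega^{\widehat\otimes})$ uniquely defines a state $\varphi$ on $\mathcal P$. Here a state $\varphi$ and a pair are related by $$\varphi(X_1^{n_1}\cdots X_d^{n_d})=\langle\Phi,\hat X_1^{n_1}\cdots\hat X_d^{n_d}\Phi\rangle\qquad\text{for all }n_1,\dots,n_d\in\mathbb N,$$ where $\Phi$ is the vacuum vector of $\Gamma(V,\tilde\Omega^{\widehat\otimes})$ and $\hat X_j=\ell^*(e_j)+a^0_j+(\ell^*(e_j))^*$ with $a^0_j=\bigoplus_na^0_{j|n}$.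
   Context: $\mathbb N=\{0,1,2,\dots\}$, $D=\{1,\dots,d\}$, $(e_j)_{j\in D}$ the canonical basis of $\mathbb C^d$. $\mathcal P$ is a $*$-algebra with $X_j^*=X_j$. A state on $\mathcal P$ is a linear functional $\varphi$, real on real polynomials, with $\varphi(1)=1$ and $\varphi(Q^*Q)\ge0$. Pre-Hilbert conventions. A pre-scalar product is a positive, possibly degenerate, Hermitian form; zero-norm vectors are those with $\langle\xi,\xi\rangle=0$. $\mathcal L_a(H)$ is the $*$-algebra of everywhere defined linear $A:H\to H$ mapping zero-norm vectors to zero-norm vectors and having an everywhere defined adjoint $A^*$. Adjoints are determined only up to operators with range in the zero-norm vectors; a choice is fixed, $A$ is self-adjoint if $A=A^*$ for some choice, and identities obtained by taking adjoints are understood modulo such operators. Direct sums are algebraic. An $\mathcal L_a(H)$-valued positive definite (PD) kernel on $V$ is a sesquilinear map $\Omega:V\times V\to\mathcal L_a(H)$ with $\sum_{s,t\in F}b_s^*\Omega(s,t)b_t\ge0$ for all finite $F\subseteq V$ and all $b:F\to\mathcal L_a(H)$. The space $\Gamma(V,\tilde\Omega^{\widehat\otimes})$. $V^{\widehat\otimes n}$ is the $n$-th symmetric algebraic tensor power of $V$, $V^{\widehat\otimes0}=\mathbb C\Phi$. The sequence $\tilde\Omega^{\widehat\otimes}=(\tilde\Omega^{\widehat\otimes}_n)_{n\in\mathbb N}$ is inductively defined as follows: $\tilde\Omega^{\widehat\otimes}_0\equiv1$ is the constant kernel on $(V^{\widehat\otimes0},\langle z,w\rangle_0=\bar zw)$;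 having defined the pre-scalar product $\langle\cdot,\cdot\rangle_m$ on $V^{\widehat\otimes m}$ for $m\le n$, $\tilde\Omega^{\widehat\otimes}_{n+1}$ is an $\mathcal L_a(V^{\widehat\otimes n},\langle\cdot,\cdot\rangle_n)$-valued PD kernel on $V$, and the pre-scalar product $\langle\cdot,\cdot\rangle_{n+1}$ on $V^{\widehat\otimes(n+1)}$ is the one given by $\langle u\widehat\otimes h,v\widehat\otimes h'\rangle_{n+1}=\langle h,\tilde\Omega^{\widehat\otimes}_{n+1}(u,v)h'\rangle_n$ ($u,v\in V$, $h,h'\in V^{\widehat\otimes n}$). $\Gamma(V,\tilde\Omega^{\widehat\otimes})$ is the orthogonal sum $\bigoplus_n(V^{\widehat\otimes n},\langle\cdot,\cdot\rangle_n)$ with creators $\ell^*(f)(f_n\widehat\otimes\cdots\widehat\otimes f_1)=f\widehat\otimes f_n\widehat\otimes\cdots\widehat\otimes f_1$, and vacuum vector $\Phi$; annihilators are the adjoints $(\ell^*(f))^*$, with $(\ell^*(f))^*\Phi=0$. $3$-diagonal structure. Let $a^0_{j|n}$ ($j\in D$, $n\in\mathbb N$) be self-adjoint operators on $(V^{\widehat\otimes n},\langle\cdot,\cdot\rangle_n)$ and $a^0_j=\bigoplus_na^0_{j|n}$. Put $a^+_j=\ell^*(e_j)$, $a^-_j=(\ell^*(e_j))^*$, $\hat X_j=a^+_j+a^0_j+a^-_j$; let $\hat{\mathcal P}$ (resp. $\hat{\mathcal P}_{\mathbb R}$) be the complex (resp. real) $*$-algebra generated by the $\hat X_j$. The pair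 $(\tilde\Omega^{\widehat\otimes},(a^0_{j|n}))$ is said to induce a $3$-diagonal structure on $\Gamma(V,\tilde\Omega^{\widehat\otimes})$ if: the $\hat X_j$ mutually commute; the pre-scalar product is real valued on $\hat{\mathcal P}_{\mathbb R}\Phi$; $a^\varepsilon_j(\hat{\mathcal P}_{\mathbb R}\Phi)\subseteq\hat{\mathcal P}_{\mathbb R}\Phi$ for all $\varepsilon\in\{+,0,-\}$, $j\in D$; and $\Phi$ is cyclic for $\hat{\mathcal P}$.
   Formalization: Uniqueness of the pair means: the pre-scalar products coincide, and the operators Ω_{n+1}(u,v) and a⁰_{j|n} coincide modulo operators with range in the zero-norm vectors (literal uniqueness fails for degenerate forms); the 3-diagonal conditions hold for some choice of the annihilators. *)

theory Defs
  imports "HOL-Analysis.Analysis" "HOL-Library.Function_Algebras" "HOL-Library.Poly_Mapping"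
    "HOL-Library.Nonpos_Ints" "HOL-Library.Multiset" "HOL-Combinatorics.Permutations"
begin

text \<open>
  The index set \<open>D = {1, ..., d}\<close> is a finite linearly ordered type \<open>'d\<close>, and
  \<open>V = complex ^ 'd\<close> with canonical basis \<open>axis j 1\<close>.
\<close>

section \<open>Polynomials and states\<close>

type_synonym 'd mpoly = "('d \<Rightarrow>\<^sub>0 nat) \<Rightarrow>\<^sub>0 complex"

definition pvar :: "'d \<Rightarrow> 'd mpoly" where
  "pvar j = Poly_Mapping.single (Poly_Mapping.single j 1) 1"

definition pstar :: "'d mpoly \<Rightarrow> 'd mpoly" where
  "pstar Q = Poly_Mapping.map cnj Q"

definition real_poly :: "'d mpoly \<Rightarrow> bool" where
  "real_poly Q \<longleftrightarrow> (\<forall>m. Poly_Mapping.lookup Q m \<in> \<real>)"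

definition is_state :: "('d mpoly \<Rightarrow> complex) \<Rightarrow> bool" where
  "is_state \<phi> \<longleftrightarrow>
     (\<forall>P Q. \<phi> (P + Q) = \<phi> P + \<phi> Q) \<and>
     (\<forall>c Q. \<phi> (Poly_Mapping.map ((*) c) Q) = c * \<phi> Q) \<and>
     (\<forall>Q. real_poly Q \<longrightarrow> \<phi> Q \<in> \<real>) \<and>
     \<phi> 1 = 1 \<and>
     (\<forall>Q. \<phi> (pstar Q * Q) \<in> \<real>\<^sub>\<ge>\<^sub>0)"


section \<open>Pre-Hilbert spaces\<close>

text \<open>
  A pre-Hilbert space is a subspace \<open>H\<close> of a space of functions \<open>'i \<Rightarrow> complex\<close> together with a
  form \<open>B\<close>, linear in its second argument. Operators are functions on the ambient type of which only
  the values on \<open>H\<close> matter.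
\<close>

definition cscale :: "complex \<Rightarrow> ('i \<Rightarrow> complex) \<Rightarrow> 'i \<Rightarrow> complex" where
  "cscale c f = (\<lambda>x. c * f x)"

type_synonym 'i form = "('i \<Rightarrow> complex) \<Rightarrow> ('i \<Rightarrow> complex) \<Rightarrow> complex"
type_synonym 'i oper = "('i \<Rightarrow> complex) \<Rightarrow> 'i \<Rightarrow> complex"

definition pre_scalar_product :: "('i \<Rightarrow> complex) set \<Rightarrow> 'i form \<Rightarrow> bool" where
  "pre_scalar_product H B \<longleftrightarrow>
     (\<forall>f\<in>H. \<forall>g\<in>H. \<forall>h\<in>H. B f (g + h) = B f g + B f h) \<and>
     (\<forall>c. \<forall>f\<in>H. \<forall>g\<in>H. B f (cscale c g) = c * B f g) \<and>
     (\<forall>f\<in>H. \<forall>g\<in>H. B g f = cnj (B f g)) \<and>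
     (\<forall>f\<in>H. B f f \<in> \<real>\<^sub>\<ge>\<^sub>0)"

definition null_vec :: "'i form \<Rightarrow> ('i \<Rightarrow> complex) \<Rightarrow> bool" where
  "null_vec B f \<longleftrightarrow> B f f = 0"

definition linear_oper :: "('i \<Rightarrow> complex) set \<Rightarrow> 'i oper \<Rightarrow> bool" where
  "linear_oper H A \<longleftrightarrow>
     (\<forall>f\<in>H. A f \<in> H) \<and>
     (\<forall>f\<in>H. \<forall>g\<in>H. A (f + g) = A f + A g) \<and>
     (\<forall>c. \<forall>f\<in>H. A (cscale c f) = cscale c (A f))"

text \<open>\<open>A'\<close> is one of the possible choices of the adjoint of \<open>A\<close>.\<close>

definition is_adjoint :: "('i \<Rightarrow> complex) set \<Rightarrow> 'i form \<Rightarrow> 'i oper \<Rightarrow> 'i oper \<Rightarrow> bool" where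
  "is_adjoint H B A A' \<longleftrightarrow>
     linear_oper H A' \<and> (\<forall>f\<in>H. \<forall>g\<in>H. B (A f) g = B f (A' g))"

definition La :: "('i \<Rightarrow> complex) set \<Rightarrow> 'i form \<Rightarrow> 'i oper set" where
  "La H B = {A. linear_oper H A \<and>
     (\<forall>f\<in>H. null_vec B f \<longrightarrow> null_vec B (A f)) \<and> (\<exists>A'. is_adjoint H B A A')}"

definition self_adjoint :: "('i \<Rightarrow> complex) set \<Rightarrow> 'i form \<Rightarrow> 'i oper \<Rightarrow> bool" where
  "self_adjoint H B A \<longleftrightarrow> A \<in> La H B \<and> is_adjoint H B A A"

text \<open>
  In the positivity condition \<open>bs s\<close> is an adjoint of \<open>b s\<close>; the value of the form does not depend
  on which one.
\<close>

definition pd_kernel ::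
  "('i \<Rightarrow> complex) set \<Rightarrow> 'i form \<Rightarrow> (complex ^ 'd \<Rightarrow> complex ^ 'd \<Rightarrow> 'i oper) \<Rightarrow> bool" where
  "pd_kernel H B K \<longleftrightarrow>
     (\<forall>u v. K u v \<in> La H B) \<and>
     (\<forall>u u' v. \<forall>h\<in>H. K (u + u') v h = K u v h + K u' v h) \<and>
     (\<forall>c u v. \<forall>h\<in>H. K (c *s u) v h = cscale (cnj c) (K u v h)) \<and>
     (\<forall>u v v'. \<forall>h\<in>H. K u (v + v') h = K u v h + K u v' h) \<and>
     (\<forall>c u v. \<forall>h\<in>H. K u (c *s v) h = cscale c (K u v h)) \<and>
     (\<forall>F b bs. finite F \<and> (\<forall>s\<in>F. b s \<in> La H B \<and> is_adjoint H B (b s) (bs s)) \<longrightarrow>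
        (\<forall>h\<in>H. B h (\<Sum>s\<in>F. \<Sum>t\<in>F. bs s (K s t (b t h))) \<in> \<real>\<^sub>\<ge>\<^sub>0))"


section \<open>Symmetric tensors\<close>

text \<open>
  An element of the tensor algebra of \<open>V\<close> is given by its coefficients: \<open>F [x\<^sub>1, ..., x\<^sub>n]\<close> is the
  coefficient of \<open>e\<^bsub>x\<^sub>1\<^esub> \<otimes> ... \<otimes> e\<^bsub>x\<^sub>n\<^esub>\<close>. Elements of degree \<open>n\<close> vanish on lists of any other length.
\<close>

type_synonym 'd tensor = "'d list \<Rightarrow> complex"

definition sym_pow :: "nat \<Rightarrow> 'd tensor set" where
  "sym_pow n = {F. (\<forall>xs. length xs \<noteq> n \<longrightarrow> F xs = 0) \<and>
                   (\<forall>xs ys. mset xs = mset ys \<longrightarrow> F xs = F ys)}"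

text \<open>\<open>u \<otimes> h\<close> for a vector \<open>u\<close>, and the projection onto the symmetric tensors\<close>

fun tensor_left :: "complex ^ 'd \<Rightarrow> 'd tensor \<Rightarrow> 'd tensor" where
  "tensor_left u h [] = 0"
| "tensor_left u h (x # xs) = u $ x * h xs"

definition symmetrize :: "'d tensor \<Rightarrow> 'd tensor" where
  "symmetrize F xs =
     (\<Sum>\<sigma> | \<sigma> permutes {..<length xs}. F (permute_list \<sigma> xs)) / fact (length xs)"

definition sym_prod :: "complex ^ 'd \<Rightarrow> 'd tensor \<Rightarrow> 'd tensor" where
  "sym_prod u h = symmetrize (tensor_left u h)"


section \<open>The interacting Fock space\<close>

type_synonym 'd kernel_seq = "nat \<Rightarrow> complex ^ 'd \<Rightarrow> complex ^ 'd \<Rightarrow> 'd list oper"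

text \<open>
  A symmetric tensor \<open>F\<close> of degree \<open>n + 1\<close> is the sum over \<open>j\<close> of the symmetric products of \<open>e\<^sub>j\<close>
  with the slice \<open>\<lambda>xs. F (j # xs)\<close>, so the form below is the only one that can satisfy the
  inductive identity
  \<open>\<langle>sym_prod u h, sym_prod v h'\<rangle>\<^bsub>n+1\<^esub> = \<langle>h, \<Omega>\<^bsub>n+1\<^esub>(u,v) h'\<rangle>\<^sub>n\<close>.
  That it does satisfy it is a condition on \<open>\<Omega>\<close>, imposed in \<open>fock_kernel\<close>.
\<close>

lemma slice_decomposition:
  fixes F :: "'d::finite tensor"
  assumes F: "F \<in> sym_pow (Suc n)"
  shows "F xs = (\<Sum>j\<in>UNIV. sym_prod (axis j 1) (\<lambda>ys. F (j # ys)) xs)"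
proof -
  have "\<forall>xs. length xs \<noteq> Suc n \<longrightarrow> F xs = 0" using F unfolding sym_pow_def by blast
  then have F0: "F [] = 0" by simp
  have slices: "(\<Sum>j\<in>UNIV. tensor_left (axis j 1) (\<lambda>ys. F (j # ys)) zs) = F zs" for zs
  proof (cases zs)
    case (Cons x ys)
    have "(\<Sum>j\<in>UNIV. axis j 1 $ x * F (j # ys)) = (\<Sum>j\<in>UNIV. if j = x then F (j # ys) else 0)"
      by (rule sum.cong) (simp_all add: axis_def)
    then show ?thesis using Cons by simp
  qed (simp add: F0)
  have inv: "F (permute_list \<sigma> xs) = F xs" if "\<sigma> permutes {..<length xs}" for \<sigma>
  proof -
    have "mset (permute_list \<sigma> xs) = mset xs" using that by (rule mset_permute_list)
    moreover have "\<forall>xs ys. mset xs = mset ys \<longrightarrow> F xs = F ys"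
      using F unfolding sym_pow_def by blast
    ultimately show ?thesis by blast
  qed
  have "(\<Sum>\<sigma> | \<sigma> permutes {..<length xs}. F (permute_list \<sigma> xs)) =
      (\<Sum>\<sigma> | \<sigma> permutes {..<length xs}. F xs)"
    by (rule sum.cong) (use inv in auto)
  also have "\<dots> = of_nat (card {\<sigma>. \<sigma> permutes {..<length xs}}) * F xs"
    by (rule sum_constant)
  also have "card {\<sigma>. \<sigma> permutes {..<length xs}} = fact (length xs)"
    by (rule card_permutations) auto
  finally have 1: "symmetrize F xs = F xs" by (simp add: symmetrize_def of_nat_fact)
  have "(\<Sum>j\<in>UNIV. sym_prod (axis j 1) (\<lambda>ys. F (j # ys)) xs) = symmetrize F xs"
    unfolding sym_prod_def symmetrize_def sum_divide_distrib[symmetric]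
    by (subst sum.swap) (simp only: slices)
  then show ?thesis by (simp only: 1)
qed

primrec ip :: "'d::finite kernel_seq \<Rightarrow> nat \<Rightarrow> 'd list form" where
  "ip \<Omega> 0 = (\<lambda>F G. cnj (F []) * G [])"
| "ip \<Omega> (Suc n) = (\<lambda>F G. \<Sum>j\<in>UNIV. \<Sum>k\<in>UNIV.
     ip \<Omega> n (\<lambda>xs. F (j # xs)) (\<Omega> (Suc n) (axis j 1) (axis k 1) (\<lambda>xs. G (k # xs))))"

definition fock_kernel :: "'d::finite kernel_seq \<Rightarrow> bool" where
  "fock_kernel \<Omega> \<longleftrightarrow>
     (\<forall>u v. \<forall>z\<in>sym_pow 0. \<Omega> 0 u v z = z) \<and>
     (\<forall>n. pd_kernel (sym_pow n) (ip \<Omega> n) (\<Omega> (Suc n)) \<and>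
          pre_scalar_product (sym_pow (Suc n)) (ip \<Omega> (Suc n)) \<and>
          (\<forall>u v. \<forall>h\<in>sym_pow n. \<forall>h'\<in>sym_pow n.
             ip \<Omega> (Suc n) (sym_prod u h) (sym_prod v h') = ip \<Omega> n h (\<Omega> (Suc n) u v h')))"

definition hom_part :: "nat \<Rightarrow> 'd tensor \<Rightarrow> 'd tensor" where
  "hom_part n F = (\<lambda>xs. if length xs = n then F xs else 0)"

text \<open>Algebraic direct sum of the \<open>sym_pow n\<close>, with the orthogonal sum of the forms\<close>

definition fock :: "'d tensor set" where
  "fock = {F. (\<forall>n. hom_part n F \<in> sym_pow n) \<and> finite {n. hom_part n F \<noteq> 0}}"

definition fock_ip :: "'d::finite kernel_seq \<Rightarrow> 'd list form" where
  "fock_ip \<Omega> F G = (\<Sum>n | hom_part n F \<noteq> 0. ip \<Omega> n (hom_part n F) (hom_part n G))"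

definition vacuum :: "'d tensor" where
  "vacuum xs = (if xs = [] then 1 else 0)"

definition creator :: "complex ^ 'd \<Rightarrow> 'd list oper" where
  "creator f F = sym_prod f F"

text \<open>\<open>am j\<close> is a choice of the adjoint of the creator \<open>creator (axis j 1)\<close>.\<close>

definition annihilators :: "'d::finite kernel_seq \<Rightarrow> ('d \<Rightarrow> 'd list oper) \<Rightarrow> bool" where
  "annihilators \<Omega> am \<longleftrightarrow>
     (\<forall>j. is_adjoint fock (fock_ip \<Omega>) (creator (axis j 1)) (am j) \<and> am j vacuum = 0)"

text \<open>Direct sum of operators \<open>A n\<close> on \<open>sym_pow n\<close>\<close>

definition oper_sum :: "(nat \<Rightarrow> 'd list oper) \<Rightarrow> 'd list oper" where
  "oper_sum A F = (\<lambda>xs. A (length xs) (hom_part (length xs) F) xs)"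

definition X_hat ::
  "('d \<Rightarrow> nat \<Rightarrow> 'd list oper) \<Rightarrow> ('d \<Rightarrow> 'd list oper) \<Rightarrow> 'd::finite \<Rightarrow> 'd list oper" where
  "X_hat a0 am j F = creator (axis j 1) F + oper_sum (a0 j) F + am j F"

text \<open>
  The unital algebra generated by the operators \<open>X j\<close> over the scalars \<open>S\<close>, where \<open>S\<close> is \<open>UNIV\<close>
  or \<open>\<real>\<close>. The operators \<open>X_hat a0 am j\<close> are self-adjoint for a suitable choice of adjoints, so
  for them this is a *-algebra.
\<close>

inductive_set gen_algebra :: "complex set \<Rightarrow> ('d \<Rightarrow> 'i oper) \<Rightarrow> 'i oper set"
  for S :: "complex set" and X :: "'d \<Rightarrow> 'i oper" where
  one: "id \<in> gen_algebra S X"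
| gen: "X j \<in> gen_algebra S X"
| add: "A \<in> gen_algebra S X \<Longrightarrow> B \<in> gen_algebra S X \<Longrightarrow> (\<lambda>F. A F + B F) \<in> gen_algebra S X"
| scale: "c \<in> S \<Longrightarrow> A \<in> gen_algebra S X \<Longrightarrow> (\<lambda>F. cscale c (A F)) \<in> gen_algebra S X"
| mult: "A \<in> gen_algebra S X \<Longrightarrow> B \<in> gen_algebra S X \<Longrightarrow> A \<circ> B \<in> gen_algebra S X"

definition orbit_of :: "complex set \<Rightarrow> ('d \<Rightarrow> 'd list oper) \<Rightarrow> 'd tensor set" where
  "orbit_of S X = (\<lambda>A. A vacuum) ` gen_algebra S X"


section \<open>3-diagonal structures\<close>

text \<open>The conditions on the pair and on the annihilators \<open>am\<close> that have been chosen\<close>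

definition three_diagonal ::
  "'d::finite kernel_seq \<Rightarrow> ('d \<Rightarrow> nat \<Rightarrow> 'd list oper) \<Rightarrow> ('d \<Rightarrow> 'd list oper) \<Rightarrow> bool" where
  "three_diagonal \<Omega> a0 am \<longleftrightarrow>
     (let X = X_hat a0 am; PR = orbit_of \<real> X in
      (\<forall>j k. \<forall>F\<in>fock. X j (X k F) = X k (X j F)) \<and>
      (\<forall>F\<in>PR. \<forall>G\<in>PR. fock_ip \<Omega> F G \<in> \<real>) \<and>
      (\<forall>j. \<forall>F\<in>PR. creator (axis j 1) F \<in> PR \<and> oper_sum (a0 j) F \<in> PR \<and> am j F \<in> PR) \<and>
      orbit_of UNIV X = fock)"

definition induces_3_diagonal ::
  "'d::finite kernel_seq \<Rightarrow> ('d \<Rightarrow> nat \<Rightarrow> 'd list oper) \<Rightarrow> bool" where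
  "induces_3_diagonal \<Omega> a0 \<longleftrightarrow>
     fock_kernel \<Omega> \<and>
     (\<forall>j n. self_adjoint (sym_pow n) (ip \<Omega> n) (a0 j n)) \<and>
     (\<exists>am. annihilators \<Omega> am \<and> three_diagonal \<Omega> a0 am)"

text \<open>
  Two choices of the annihilators differ by operators with range in the zero-norm vectors, which do
  not affect the moments; hence the quantifier over all choices. The product of powers is applied
  in the order of \<open>D\<close>.
\<close>

definition same_moments ::
  "('d::{finite,linorder} mpoly \<Rightarrow> complex) \<Rightarrow> 'd kernel_seq \<Rightarrow> ('d \<Rightarrow> nat \<Rightarrow> 'd list oper) \<Rightarrow> bool" where
  "same_moments \<phi> \<Omega> a0 \<longleftrightarrow>
     (\<forall>am. annihilators \<Omega> am \<longrightarrow> (\<forall>n :: 'd \<Rightarrow> nat.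
        \<phi> (\<Prod>j\<in>UNIV. pvar j ^ n j) =
        fock_ip \<Omega> vacuum
          (foldr (\<lambda>j. X_hat a0 am j ^^ n j) (sorted_list_of_set UNIV) vacuum)))"

text \<open>
  Equality of pairs: the same pre-scalar products, and operators that agree up to operators with
  range in the zero-norm vectors. Since the pre-scalar products see the operators only through
  their matrix elements, this is the identification under which a pair can be unique.
\<close>

definition pair_eq ::
  "'d::finite kernel_seq \<Rightarrow> ('d \<Rightarrow> nat \<Rightarrow> 'd list oper) \<Rightarrow>
   'd kernel_seq \<Rightarrow> ('d \<Rightarrow> nat \<Rightarrow> 'd list oper) \<Rightarrow> bool" where
  "pair_eq \<Omega> a0 \<Omega>' a0' \<longleftrightarrow>
     (\<forall>n. \<forall>F\<in>sym_pow n. \<forall>G\<in>sym_pow n. ip \<Omega> n F G = ip \<Omega>' n F G) \<and>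
     (\<forall>u v. \<forall>z\<in>sym_pow 0. \<Omega> 0 u v z = \<Omega>' 0 u v z) \<and>
     (\<forall>n u v. \<forall>h\<in>sym_pow n. null_vec (ip \<Omega> n) (\<Omega> (Suc n) u v h - \<Omega>' (Suc n) u v h)) \<and>
     (\<forall>j n. \<forall>h\<in>sym_pow n. null_vec (ip \<Omega> n) (a0 j n h - a0' j n h))"

end

theory Submission
  imports Defs
begin

text \<open>
  Symmetric tensors are identified with polynomials so that the creator of \<open>e\<^sub>j\<close> becomes
  multiplication by \<open>X\<^sub>j\<close>. Given a state, subtract from every monomial a real orthogonal projection
  onto the polynomials of lower degree; this extends to a linear bijection \<open>P\<close> of the polynomials
  that respects the degree filtration. Pulling back the form \<open>\<phi>(q\<^sup>* r)\<close> and the multiplication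
  operators along \<open>P\<close> turns the degrees into orthogonal summands and makes multiplication by \<open>X\<^sub>j\<close>
  three-diagonal up to null vectors, its part that raises the degree being exactly the creator.

  Conversely, for a pair let \<open>T q = q(X)\<Phi>\<close>. Then \<open>\<phi> q = \<langle>\<Phi>, T q\<rangle>\<close> is a state, and the moments do not
  depend on the choice of the annihilators, since these only enter through their matrix elements. If
  the pair realizes \<open>\<phi>\<close>, induction on the degree shows \<open>q = T (P q)\<close> modulo null vectors, so all matrix
  elements of the pair are determined by \<open>\<phi>\<close> and \<open>P\<close>; this is uniqueness.
\<close>

section \<open>Polynomials\<close>

text \<open>The form of a state may be degenerate, whereas commutativity and cyclicity are demanded
  exactly. So no quotient by null vectors is taken: the projections are arbitrary choices,
  \<open>P\<close> remains bijective on all polynomials, and conjugation by it is exact.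
  Multiplication by a variable is symmetric for the form and raises the degree by at most one, hence
  lowers it by at most one modulo null vectors; this is the three-term recurrence in several
  variables. The projections are taken real because the real orbit has to be stable under each of
  the three parts separately.

  For uniqueness, vectors cannot be compared directly: the annihilators of an arbitrary pair are
  known only through the form. Equalities are therefore tested under the form against every vector,
  and symmetric operators are moved onto the test vector. The arbitrariness of \<open>P\<close> does
  no harm, since \<open>P\<close> depends on the state alone and the same \<open>P\<close> is used
  for both pairs.\<close>

abbreviation cst :: "complex \<Rightarrow> 'd mpoly" where
  "cst c \<equiv> Poly_Mapping.single 0 c"

abbreviation monom :: "('d \<Rightarrow>\<^sub>0 nat) \<Rightarrow> 'd mpoly" where
  "monom m \<equiv> Poly_Mapping.single m 1"

lemma lookup_map_zero:
  "f 0 = 0 \<Longrightarrow> Poly_Mapping.lookup (Poly_Mapping.map f q) m = f (Poly_Mapping.lookup q m)"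
  by (simp add: Poly_Mapping.map.rep_eq when_def)

lemma lookup_cst_mult [simp]:
  "Poly_Mapping.lookup (cst c * q) m = c * Poly_Mapping.lookup q m"
  by (simp add: mult_map_scale_conv_mult[symmetric] lookup_map_zero)

lemma cst_mult_cst: "cst a * (cst b * q) = cst (a * b) * q"
  by (simp add: mult.assoc[symmetric] mult_single)

lemma monom_mult: "monom m * monom m' = monom (m + m')"
  by (simp add: mult_single)

lemma monom_Cons: "monom (Poly_Mapping.single j (Suc 0) + m) = pvar j * monom m"
  by (simp add: pvar_def mult_single)

lemma mpoly_expand: "q = (\<Sum>m\<in>Poly_Mapping.keys q. cst (Poly_Mapping.lookup q m) * monom m)"
  by (rule poly_mapping_eqI)
    (auto simp: lookup_sum lookup_single when_def in_keys_iff if_distrib[of "(*) _"] cong: if_cong)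

lemma mpoly_closure:
  assumes "R 0" "\<And>q r. R q \<Longrightarrow> R r \<Longrightarrow> R (q + r)"
    and "\<And>m. m \<in> Poly_Mapping.keys q \<Longrightarrow> R (cst (Poly_Mapping.lookup q m) * monom m)"
  shows "R q"
proof -
  have "finite M \<Longrightarrow> M \<subseteq> Poly_Mapping.keys q \<Longrightarrow>
      R (\<Sum>m\<in>M. cst (Poly_Mapping.lookup q m) * monom m)" for M
    by (induction M rule: finite_induct) (auto simp: assms)
  from this[of "Poly_Mapping.keys q"] show ?thesis
    by (subst mpoly_expand) simp
qed

definition mdeg :: "('d::finite \<Rightarrow>\<^sub>0 nat) \<Rightarrow> nat" where
  "mdeg m = (\<Sum>j\<in>UNIV. Poly_Mapping.lookup m j)"

lemma mdeg_zero [simp]: "mdeg 0 = 0"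
  by (simp add: mdeg_def)

lemma mdeg_add [simp]: "mdeg (m + m') = mdeg m + mdeg m'"
  by (simp add: mdeg_def lookup_add sum.distrib)

lemma mdeg_single [simp]: "mdeg (Poly_Mapping.single j k) = k"
  by (simp add: mdeg_def lookup_single when_def)

lemma exponent_cases:
  fixes m :: "'d::finite \<Rightarrow>\<^sub>0 nat"
  assumes "mdeg m = Suc n"
  obtains j m' where "m = Poly_Mapping.single j (Suc 0) + m'" "mdeg m' = n"
proof -
  obtain j where j: "Poly_Mapping.lookup m j \<noteq> 0"
    using assms by (fastforce simp: mdeg_def)
  define m' where "m' = m - Poly_Mapping.single j (Suc 0)"
  have m: "m = Poly_Mapping.single j (Suc 0) + m'"
    using j by (intro poly_mapping_eqI)
      (auto simp: m'_def lookup_add lookup_minus lookup_single when_def)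
  with assms have "mdeg m' = n" by simp
  with m that show thesis by blast
qed

lemma exponent_induct [case_names zero single]:
  fixes m :: "'d::finite \<Rightarrow>\<^sub>0 nat"
  assumes "R 0" and "\<And>j m. R m \<Longrightarrow> R (Poly_Mapping.single j (Suc 0) + m)"
  shows "R m"
proof (induction "mdeg m" arbitrary: m)
  case 0
  then have "m = 0" by (intro poly_mapping_eqI) (simp add: mdeg_def)
  with assms(1) show ?case by simp
next
  case (Suc n)
  then show ?case by (metis assms(2) exponent_cases)
qed

lemma mpoly_induct [case_names one scale add pvar]:
  fixes q :: "'d::finite mpoly"
  assumes one: "R 1" and scale: "\<And>c q. R q \<Longrightarrow> R (cst c * q)"
    and add: "\<And>q r. R q \<Longrightarrow> R r \<Longrightarrow> R (q + r)" and pvar: "\<And>j q. R q \<Longrightarrow> R (pvar j * q)"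
  shows "R q"
proof (rule mpoly_closure)
  show "R 0" using scale[OF one, of 0] by simp
  have "R (monom m)" for m :: "'d \<Rightarrow>\<^sub>0 nat"
    by (induction m rule: exponent_induct) (use one pvar in \<open>simp_all add: monom_Cons\<close>)
  then show "R (cst (Poly_Mapping.lookup q m) * monom m)" for m by (rule scale)
qed (rule add)

section \<open>Linear maps between polynomials, and linear extension from monomials\<close>

definition plinear :: "('d mpoly \<Rightarrow> 'd mpoly) \<Rightarrow> bool" where
  "plinear L \<longleftrightarrow> (\<forall>q r. L (q + r) = L q + L r) \<and> (\<forall>c q. L (cst c * q) = cst c * L q)"

lemma plinear_add: "plinear L \<Longrightarrow> L (q + r) = L q + L r"
  and plinear_scale: "plinear L \<Longrightarrow> L (cst c * q) = cst c * L q"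
  by (simp_all add: plinear_def)

lemma plinear_zero: "plinear L \<Longrightarrow> L 0 = 0"
  using plinear_scale[of L 0 0] by simp

lemma plinear_minus: "plinear L \<Longrightarrow> L (- q) = - L q"
  using plinear_scale[of L "-1" q] by (simp add: single_uminus)

lemma plinear_diff: "plinear L \<Longrightarrow> L (q - r) = L q - L r"
  using plinear_add[of L q "- r"] by (simp add: plinear_minus)

lemma plinear_sum: "plinear L \<Longrightarrow> L (sum f I) = (\<Sum>i\<in>I. L (f i))"
  by (induction I rule: infinite_finite_induct) (simp_all add: plinear_zero plinear_add)

lemma plinear_eqI:
  fixes L L' :: "'d::finite mpoly \<Rightarrow> 'd mpoly"
  assumes "plinear L" "plinear L'" and "\<And>m. L (monom m) = L' (monom m)"
  shows "L q = L' q"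
  by (rule mpoly_closure[of _ q])
    (simp_all add: assms plinear_zero plinear_add plinear_scale)

definition lin_ext :: "(('d \<Rightarrow>\<^sub>0 nat) \<Rightarrow> 'd mpoly) \<Rightarrow> 'd mpoly \<Rightarrow> 'd mpoly" where
  "lin_ext f q = (\<Sum>m\<in>Poly_Mapping.keys q. cst (Poly_Mapping.lookup q m) * f m)"

lemma lin_ext_superset:
  assumes "finite M" "Poly_Mapping.keys q \<subseteq> M"
  shows "lin_ext f q = (\<Sum>m\<in>M. cst (Poly_Mapping.lookup q m) * f m)"
  unfolding lin_ext_def
  by (rule sum.mono_neutral_left) (use assms in \<open>auto simp: in_keys_iff\<close>)

lemma plinear_lin_ext: "plinear (lin_ext f)"
  unfolding plinear_def
proof (intro conjI allI)
  fix q r :: "'a mpoly"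
  let ?M = "Poly_Mapping.keys q \<union> Poly_Mapping.keys r"
  have "lin_ext f (q + r) = (\<Sum>m\<in>?M. cst (Poly_Mapping.lookup (q + r) m) * f m)"
    by (rule lin_ext_superset) (simp_all add: keys_add)
  also have "\<dots> = lin_ext f q + lin_ext f r"
    by (subst (1 2) lin_ext_superset[of ?M]) (auto simp: lookup_add single_add distrib_right sum.distrib)
  finally show "lin_ext f (q + r) = lin_ext f q + lin_ext f r" .
next
  fix c and q :: "'a mpoly"
  have "lin_ext f (cst c * q) = (\<Sum>m\<in>Poly_Mapping.keys q. cst (Poly_Mapping.lookup (cst c * q) m) * f m)"
    by (rule lin_ext_superset) (auto simp: in_keys_iff)
  then show "lin_ext f (cst c * q) = cst c * lin_ext f q"
    by (simp add: lin_ext_def sum_distrib_left cst_mult_cst)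
qed

lemma lin_ext_monom [simp]: "lin_ext f (monom m) = f m"
  by (simp add: lin_ext_def)

section \<open>Homogeneous components and the filtration by degree\<close>

definition restr :: "('d \<Rightarrow>\<^sub>0 nat) set \<Rightarrow> 'd mpoly \<Rightarrow> 'd mpoly" where
  "restr M q = Poly_Mapping.Abs_poly_mapping (\<lambda>m. if m \<in> M then Poly_Mapping.lookup q m else 0)"

lemma lookup_restr [simp]:
  "Poly_Mapping.lookup (restr M q) m = (if m \<in> M then Poly_Mapping.lookup q m else 0)"
  unfolding restr_def
  by (subst lookup_Abs_poly_mapping) (auto intro: finite_subset[OF _ finite_lookup[of q]])

lemma plinear_restr: "plinear (restr M)"
  by (auto simp: plinear_def lookup_add intro!: poly_mapping_eqI)

abbreviation hom :: "nat \<Rightarrow> 'd::finite mpoly \<Rightarrow> 'd mpoly" where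
  "hom n \<equiv> restr {m. mdeg m = n}"

text \<open>The strict bound makes \<open>deg_less 0\<close> the zero space, so inductions along the
  filtration start trivially and the zero polynomial needs no degree.\<close>

definition deg_less :: "nat \<Rightarrow> 'd::finite mpoly set" where
  "deg_less n = {q. \<forall>m. Poly_Mapping.lookup q m \<noteq> 0 \<longrightarrow> mdeg m < n}"

lemma deg_less_zero [simp]: "0 \<in> deg_less n"
  and deg_less_add: "q \<in> deg_less n \<Longrightarrow> r \<in> deg_less n \<Longrightarrow> q + r \<in> deg_less n"
  and deg_less_scale: "q \<in> deg_less n \<Longrightarrow> cst c * q \<in> deg_less n"
  and deg_less_0D: "q \<in> deg_less 0 \<Longrightarrow> q = 0"
  by (auto simp: deg_less_def lookup_add intro!: poly_mapping_eqI) (metis add_0)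

lemma deg_less_minus: "q \<in> deg_less n \<Longrightarrow> - q \<in> deg_less n"
  and deg_less_diff: "q \<in> deg_less n \<Longrightarrow> r \<in> deg_less n \<Longrightarrow> q - r \<in> deg_less n"
  by (auto simp: deg_less_def lookup_minus) (metis diff_zero)

lemma deg_less_mono: "q \<in> deg_less n \<Longrightarrow> n \<le> k \<Longrightarrow> q \<in> deg_less k"
  by (force simp: deg_less_def)

lemma deg_less_monom [simp]: "monom m \<in> deg_less n \<longleftrightarrow> mdeg m < n"
  by (auto simp: deg_less_def lookup_single when_def)

lemma deg_less_hom: "hom n q \<in> deg_less (Suc n)"
  by (auto simp: deg_less_def split: if_splits)

lemma deg_less_ex: "\<exists>n. q \<in> deg_less n"
proof -
  have "q \<in> deg_less (Suc (\<Sum>m\<in>Poly_Mapping.keys q. mdeg m))"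
    by (auto simp: deg_less_def less_Suc_eq_le in_keys_iff intro!: member_le_sum)
  then show ?thesis ..
qed

lemma deg_less_closure:
  fixes q :: "'d::finite mpoly"
  assumes "q \<in> deg_less n" "R 0" "\<And>q r. R q \<Longrightarrow> R r \<Longrightarrow> R (q + r)"
    and "\<And>c m. mdeg m < n \<Longrightarrow> R (cst c * monom m)"
  shows "R q"
  by (rule mpoly_closure) (use assms in \<open>auto simp: deg_less_def in_keys_iff\<close>)

lemma pvar_mult_deg_less:
  assumes "q \<in> deg_less n"
  shows "pvar j * q \<in> deg_less (Suc n)"
  using assms
proof (rule deg_less_closure)
  fix c and m :: "'a \<Rightarrow>\<^sub>0 nat" assume "mdeg m < n"
  then show "pvar j * (cst c * monom m) \<in> deg_less (Suc n)"
    by (simp add: mult.left_commute[of "pvar j"] monom_Cons[symmetric] deg_less_scale)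
qed (simp_all add: distrib_left deg_less_add)

lemma hom_monom [simp]: "hom n (monom m) = (if mdeg m = n then monom m else 0)"
  by (auto intro!: poly_mapping_eqI simp: lookup_single when_def)

lemma hom_pvar_mult: "hom (Suc n) (pvar j * q) = pvar j * hom n q"
proof -
  have "plinear (\<lambda>q. hom (Suc n) (pvar j * q))" "plinear (\<lambda>q. pvar j * hom n q)"
    by (simp_all add: plinear_def plinear_add[OF plinear_restr] plinear_scale[OF plinear_restr]
        distrib_left mult.left_commute[of "pvar j"])
  then show ?thesis
    by (rule plinear_eqI) (auto simp: monom_Cons[symmetric])
qed

lemma hom_hom [simp]: "hom n (hom k q) = (if n = k then hom n q else 0)"
  by (auto intro!: poly_mapping_eqI)

lemma hom_eqI:
  assumes "\<And>n. hom n q = hom n r"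
  shows "q = r"
proof (rule poly_mapping_eqI)
  fix m
  have "Poly_Mapping.lookup (hom (mdeg m) q) m = Poly_Mapping.lookup (hom (mdeg m) r) m"
    by (simp only: assms)
  then show "Poly_Mapping.lookup q m = Poly_Mapping.lookup r m" by simp
qed

lemma hom_Suc_deg_less: "q \<in> deg_less (Suc n) \<Longrightarrow> q - hom n q \<in> deg_less n"
  by (auto simp: deg_less_def lookup_minus less_Suc_eq split: if_splits)

lemma hom_eq_0_deg_less: "q \<in> deg_less n \<Longrightarrow> n \<le> k \<Longrightarrow> hom k q = 0"
  by (rule poly_mapping_eqI) (force simp: deg_less_def)

lemma sum_hom: "q \<in> deg_less n \<Longrightarrow> q = (\<Sum>k<n. hom k q)"
  by (intro poly_mapping_eqI) (auto simp: lookup_sum deg_less_def)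

section \<open>The involution\<close>

lemma lookup_pstar [simp]: "Poly_Mapping.lookup (pstar q) m = cnj (Poly_Mapping.lookup q m)"
  by (simp add: pstar_def lookup_map_zero)

lemma pstar_add: "pstar (q + r) = pstar q + pstar r"
  and pstar_pstar [simp]: "pstar (pstar q) = q"
  and pstar_scale: "pstar (cst c * q) = cst (cnj c) * pstar q"
  and pstar_zero [simp]: "pstar 0 = 0"
  by (auto intro!: poly_mapping_eqI simp: lookup_add)

lemma pstar_diff: "pstar (q - r) = pstar q - pstar r"
  by (auto intro!: poly_mapping_eqI simp: lookup_minus)

lemma pstar_monom [simp]: "pstar (monom m) = monom m"
  by (auto intro!: poly_mapping_eqI simp: lookup_single when_def)

lemma pstar_one [simp]: "pstar 1 = 1"
  using pstar_monom[of 0] by simp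

lemma pstar_pvar_mult: "pstar (pvar j * q) = pvar j * pstar (q :: 'd::finite mpoly)"
proof (induction q rule: mpoly_closure)
  case (3 m)
  show ?case
    by (simp add: mult.left_commute[of "pvar j"] monom_Cons[symmetric] pstar_scale)
qed (simp_all add: distrib_left pstar_add)

lemma pstar_mult: "pstar (q * r) = pstar q * pstar (r :: 'd::finite mpoly)"
  by (induction q rule: mpoly_induct)
    (simp_all add: pstar_scale pstar_add pstar_pvar_mult distrib_right mult.assoc)

lemma real_poly_iff_pstar: "real_poly q \<longleftrightarrow> pstar q = q"
  by (auto simp: real_poly_def poly_mapping_eq_iff fun_eq_iff Reals_cnj_iff)

lemma pvar_power: "pvar j ^ n = monom (Poly_Mapping.single j n)"
proof (induction n)
  case (Suc n)
  then show ?case using monom_mult[of "Poly_Mapping.single j (Suc 0)" "Poly_Mapping.single j n"]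
    by (simp add: pvar_def single_add[symmetric])
qed simp

lemma monom_prod_pvar: "monom m = (\<Prod>j\<in>UNIV. pvar j ^ Poly_Mapping.lookup m (j :: 'd::finite))"
proof -
  have "(\<Prod>j\<in>J. pvar j ^ Poly_Mapping.lookup m j) =
      monom (\<Sum>j\<in>J. Poly_Mapping.single j (Poly_Mapping.lookup m j))" if "finite J" for J
    using that by (induction J rule: finite_induct) (simp_all add: pvar_power monom_mult)
  moreover have "(\<Sum>j\<in>UNIV. Poly_Mapping.single j (Poly_Mapping.lookup m j)) = m"
    by (rule poly_mapping_eqI) (simp add: lookup_sum lookup_single when_def)
  ultimately show ?thesis by simp
qed

section \<open>Semi-inner products on polynomials\<close>

text \<open>For small \<open>c\<close> the linear term outweighs the quadratic one, and the
  direction \<open>- cnj z\<close> makes it negative unless \<open>z\<close> vanishes.\<close>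

lemma Re_quadratic_eq_0:
  assumes "\<And>c::complex. 0 \<le> 2 * Re (c * z) + (cmod c)\<^sup>2 * b"
  shows "z = 0"
proof -
  \<comment> \<open>All that matters is \<open>t > 0\<close> and \<open>t * b < 2\<close>; the
    absolute value keeps the denominator positive for either sign of \<open>b\<close>.\<close>
  define t where "t = 1 / (\<bar>b\<bar> + 1)"
  have t: "t > 0" "t * b < 1"
    by (auto simp: t_def divide_simps)
  have "0 \<le> 2 * Re (- of_real t * cnj z * z) + (cmod (- of_real t * cnj z))\<^sup>2 * b"
    using assms by blast
  also have "- of_real t * cnj z * z = of_real (- t * (cmod z)\<^sup>2)"
    using complex_norm_square[of z] by (simp add: mult_ac)
  also have "2 * Re (of_real (- t * (cmod z)\<^sup>2)) + (cmod (- of_real t * cnj z))\<^sup>2 * b =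
      (cmod z)\<^sup>2 * t * (t * b - 2)"
    by (simp add: norm_mult power_mult_distrib algebra_simps power2_eq_square)
  finally have "0 \<le> (cmod z)\<^sup>2 * t * (t * b - 2)" .
  then have "(cmod z)\<^sup>2 * t \<le> 0"
    using t by (auto simp: zero_le_mult_iff)
  then have "(cmod z)\<^sup>2 \<le> 0" using t by (simp add: mult_le_0_iff)
  then show ?thesis by simp
qed

lemma nonneg_Reals_iff: "z \<in> \<real>\<^sub>\<ge>\<^sub>0 \<longleftrightarrow> Im z = 0 \<and> 0 \<le> Re z"
  by (auto simp: complex_nonneg_Reals_iff)

text \<open>The common frame for the form of a state, its pullback along \<open>P\<close>, each
  single level of the Fock space and the orthogonal sum of the levels. Being total on polynomials,
  these forms need no membership conditions.\<close>

locale semi_form =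
  fixes B :: "'d::finite mpoly \<Rightarrow> 'd mpoly \<Rightarrow> complex"
  assumes add: "B f (g + h) = B f g + B f h"
    and scale: "B f (cst c * g) = c * B f g"
    and herm: "B g f = cnj (B f g)"
    and pos: "B f f \<in> \<real>\<^sub>\<ge>\<^sub>0"
begin

lemma add_left: "B (f + g) h = B f h + B g h"
  using add[of h f g] by (simp add: herm[of h] herm[of h "f + g"] complex_cnj_add[symmetric] del: complex_cnj_add)

lemma scale_left: "B (cst c * f) g = cnj c * B f g"
  using scale[of g c f] herm[of "cst c * f" g] herm[of f g] by simp

lemma zero [simp]: "B f 0 = 0"
  using scale[of f 0 0] by simp

lemma zero_left [simp]: "B 0 f = 0"
  using herm[of 0 f] by simp

lemma minus: "B f (- g) = - B f g"
  using scale[of f "-1" g] by (simp add: single_uminus)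

lemma diff: "B f (g - h) = B f g - B f h"
  using add[of f g "- h"] by (simp add: minus)

lemma minus_left: "B (- f) g = - B f g"
  using herm[of "- f" g] herm[of f g] by (simp add: minus)

lemma diff_left: "B (f - g) h = B f h - B g h"
  using add_left[of f "- g" h] by (simp add: minus_left)

lemma sum_right: "B f (sum g I) = (\<Sum>i\<in>I. B f (g i))"
  by (induction I rule: infinite_finite_induct) (simp_all add: add)

lemma sum_left: "B (sum f I) g = (\<Sum>i\<in>I. B (f i) g)"
  by (induction I rule: infinite_finite_induct) (simp_all add: add_left)

text \<open>The degenerate case of Cauchy-Schwarz: the norm square of
  \<open>cst (cnj c) * g + f\<close> has no constant term in \<open>c\<close>, so its nonnegativity
  for every \<open>c\<close> kills the linear term \<open>B g f\<close>. This is what allows one to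
  calculate modulo null vectors.\<close>

lemma null:
  assumes "B f f = 0"
  shows "B g f = 0" "B f g = 0"
proof -
  show 0: "B g f = 0"
  proof (rule Re_quadratic_eq_0)
    fix c
    define h where "h = cst (cnj c) * g + f"
    have "0 \<le> Re (B h h)"
      using pos[of h] by (simp add: nonneg_Reals_iff)
    also have "B h h = c * B g f + cnj (c * B g f) + complex_of_real ((cmod c)\<^sup>2) * B g g"
    proof -
      have "B h h = c * (cnj c * B g g) + c * B g f + (cnj c * B f g + B f f)"
        unfolding h_def by (simp add: add add_left scale scale_left distrib_left)
      then show ?thesis
        using herm[of f g] assms complex_norm_square[of c] by (simp add: algebra_simps)
    qed
    also have "Re \<dots> = 2 * Re (c * B g f) + (cmod c)\<^sup>2 * Re (B g g)" by simp
    finally show "0 \<le> 2 * Re (c * B g f) + (cmod c)\<^sup>2 * Re (B g g)" .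
  qed
  then show "B f g = 0" using herm[of f g] by simp
qed

lemma semi_form_eq_0_if_monom:
  assumes "\<And>m. m \<in> Poly_Mapping.keys q \<Longrightarrow> B (monom m) r = 0"
  shows "B q r = 0"
  by (rule mpoly_closure[of _ q]) (simp_all add: add_left scale_left assms)

text \<open>Gram-Schmidt, one monomial at a time: a new monomial is first made orthogonal to the
  previous ones, and \<open>q\<close> is then corrected along the resulting vector \<open>v\<close>.
  Existence is all one gets, since null vectors can be added to a projection.\<close>

lemma ex_projection:
  assumes "finite M"
  shows "\<exists>r. Poly_Mapping.keys r \<subseteq> M \<and> (\<forall>m\<in>M. B (monom m) (q - r) = 0)"
  using assms
proof (induction M arbitrary: q rule: finite_induct)
  case (insert a M)
  obtain s where s: "Poly_Mapping.keys s \<subseteq> M" "\<And>m. m \<in> M \<Longrightarrow> B (monom m) (monom a - s) = 0"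
    using insert.IH[of "monom a"] by blast
  obtain r where r: "Poly_Mapping.keys r \<subseteq> M" "\<And>m. m \<in> M \<Longrightarrow> B (monom m) (q - r) = 0"
    using insert.IH[of q] by blast
  define v where "v = monom a - s"
  define c where "c = B v (q - r) / B v v"
  define r' where "r' = r + cst c * v"
  have key: "B (monom m) (q - r') = 0" if "m \<in> M" for m
    using r(2)[OF that] s(2)[OF that] by (simp add: r'_def v_def[symmetric] diff add scale)
  have "B v (q - r') = 0"
  proof (cases "B v v = 0")
    case True
    then show ?thesis by (rule null)
  next
    case False
    then show ?thesis by (simp add: r'_def c_def diff add scale)
  qed
  moreover have "B s (q - r') = 0"
    by (rule semi_form_eq_0_if_monom) (use s(1) key in auto)
  ultimately have "B (monom a) (q - r') = 0"
    using add_left[of v s] by (simp add: v_def)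
  moreover have "Poly_Mapping.keys r' \<subseteq> insert a M"
  proof
    fix m assume m: "m \<in> Poly_Mapping.keys r'"
    show "m \<in> insert a M"
    proof (rule ccontr)
      assume "m \<notin> insert a M"
      moreover from this have "Poly_Mapping.lookup r m = 0" "Poly_Mapping.lookup s m = 0"
        using r(1) s(1) by (auto simp: in_keys_iff)
      ultimately show False
        using m by (simp add: r'_def v_def in_keys_iff lookup_add lookup_minus lookup_single)
    qed
  qed
  ultimately show ?case using key by blast
qed auto

end

section \<open>The form of a state and its orthogonal polynomials\<close>

locale state_form =
  fixes \<phi> :: "'d::finite mpoly \<Rightarrow> complex"
  assumes state: "is_state \<phi>"
begin

lemma phi_add: "\<phi> (q + r) = \<phi> q + \<phi> r"
  and phi_scale: "\<phi> (cst c * q) = c * \<phi> q"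
  and phi_one: "\<phi> 1 = 1"
  and phi_real: "real_poly q \<Longrightarrow> \<phi> q \<in> \<real>"
  and phi_pos: "\<phi> (pstar q * q) \<in> \<real>\<^sub>\<ge>\<^sub>0"
  using state by (simp_all add: is_state_def mult_map_scale_conv_mult)

lemma phi_zero [simp]: "\<phi> 0 = 0"
  using phi_scale[of 0 0] by simp

text \<open>Reality is assumed on real polynomials only. Applied to the two real polynomials
  \<open>q + pstar q\<close> and i times \<open>q - pstar q\<close>, it gives the real and the
  imaginary part of the claim.\<close>

lemma phi_pstar: "\<phi> (pstar q) = cnj (\<phi> q)"
proof -
  have "\<phi> (q + pstar q) \<in> \<real>"
    by (rule phi_real) (simp add: real_poly_iff_pstar pstar_add add.commute)
  moreover have "\<phi> (cst \<i> * q + cst (- \<i>) * pstar q) \<in> \<real>"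
    by (rule phi_real) (simp add: real_poly_iff_pstar pstar_add pstar_scale add.commute)
  ultimately show ?thesis
    by (auto simp: phi_add phi_scale complex_is_Real_iff complex_eq_iff)
qed

sublocale inner: semi_form "\<lambda>q r. \<phi> (pstar q * r)"
proof
  show "\<phi> (pstar g * f) = cnj (\<phi> (pstar f * g))" for f g
    by (simp add: phi_pstar[symmetric] pstar_mult mult.commute)
  show "\<phi> (pstar f * (cst c * g)) = c * \<phi> (pstar f * g)" for f g c
    by (metis mult.left_commute phi_scale)
qed (simp_all add: phi_pos phi_add distrib_left)

end

lemma finite_mdeg_less: "finite {m :: 'd::finite \<Rightarrow>\<^sub>0 nat. mdeg m < n}"
proof (induction n)
  case (Suc n)
  have "{m :: 'd \<Rightarrow>\<^sub>0 nat. mdeg m < Suc n} \<subseteq> insert 0 (\<Union>j. (\<lambda>m. Poly_Mapping.single j (Suc 0) + m) ` {m. mdeg m < n})"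
  proof
    fix m :: "'d \<Rightarrow>\<^sub>0 nat" assume m: "m \<in> {m. mdeg m < Suc n}"
    show "m \<in> insert 0 (\<Union>j. (\<lambda>m. Poly_Mapping.single j (Suc 0) + m) ` {m. mdeg m < n})"
    proof (cases "mdeg m")
      case 0
      then have "m = 0" by (intro poly_mapping_eqI) (simp add: mdeg_def)
      then show ?thesis by simp
    next
      case (Suc k)
      then show ?thesis using m by (auto elim!: exponent_cases)
    qed
  qed
  then show ?case by (rule finite_subset) (use Suc in auto)
qed simp

text \<open>\<open>P\<close> replaces monomials by orthogonal polynomials in several variables:
  leading parts are kept, and different degrees become orthogonal. Within one degree no
  orthogonality is asked for, so no basis has to be singled out.\<close>

locale orth_poly = state_form \<phi> for \<phi> :: "'d::finite mpoly \<Rightarrow> complex" +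
  fixes P :: "'d mpoly \<Rightarrow> 'd mpoly"
  assumes P_linear: "plinear P"
    and P_lower: "q \<in> deg_less (Suc n) \<Longrightarrow> P q - q \<in> deg_less n"
    and P_orth: "v \<in> deg_less n \<Longrightarrow> \<phi> (pstar v * P (hom n q)) = 0"
    and P_real: "P (pstar q) = pstar (P q)"
begin

lemma P_deg_less: "q \<in> deg_less n \<Longrightarrow> P q \<in> deg_less n"
  using deg_less_add[of "P q - q" n q] P_lower[of q n] deg_less_mono[of q n "Suc n"] by simp

lemma P_one: "P 1 = 1"
  using deg_less_0D[OF P_lower[of 1 0]] deg_less_monom[of 0 "Suc 0"] by simp

text \<open>A polynomial killed by \<open>P\<close> is, up to sign, its own correction term, so its
  degree bound drops again and again until it is zero.\<close>

lemma inj_P: "inj P"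
proof (rule injI)
  fix q r assume "P q = P r"
  then have 0: "P (q - r) = 0" by (simp add: plinear_diff[OF P_linear])
  have "q - r \<in> deg_less n \<Longrightarrow> q - r = 0" for n
  proof (induction n)
    case (Suc n)
    then show ?case using P_lower[OF Suc.prems] deg_less_minus[of "- (q - r)" n] 0 by simp
  qed (rule deg_less_0D)
  then show "q = r" using deg_less_ex[of "q - r"] by auto
qed

text \<open>The error \<open>v - P v\<close> of the first guess \<open>v\<close> has a smaller
  degree bound, so a preimage of the error repairs the guess. The bound on the preimage says that
  the inverse of \<open>P\<close> respects the filtration too.\<close>

lemma P_onto: "v \<in> deg_less n \<Longrightarrow> \<exists>q\<in>deg_less n. P q = v"
proof (induction n arbitrary: v)
  case 0
  then show ?case using plinear_zero[OF P_linear] deg_less_0D by blast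
next
  case (Suc n)
  have "v - P v \<in> deg_less n"
    using deg_less_minus[OF P_lower[OF Suc.prems]] by simp
  then obtain w where w: "w \<in> deg_less n" "P w = v - P v" using Suc.IH by blast
  then have "P (v + w) = v" by (simp add: plinear_add[OF P_linear])
  moreover have "v + w \<in> deg_less (Suc n)"
    using Suc.prems deg_less_mono[OF w(1), of "Suc n"] by (simp add: deg_less_add)
  ultimately show ?case by blast
qed

lemma bij_P: "bij P"
  using inj_P P_onto deg_less_ex by (metis bijI surjI surj_def)

end

lemma ex_orth_poly:
  fixes \<phi> :: "'d::finite mpoly \<Rightarrow> complex"
  assumes "is_state \<phi>"
  shows "\<exists>P. orth_poly \<phi> P"
proof -
  interpret state_form \<phi> by unfold_locales (rule assms)
  have "\<exists>r. r \<in> deg_less (mdeg m) \<and> pstar r = r \<and>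
      (\<forall>m'. mdeg m' < mdeg m \<longrightarrow> \<phi> (monom m' * (monom m - r)) = 0)" for m :: "'d \<Rightarrow>\<^sub>0 nat"
  proof -
    obtain r where r: "Poly_Mapping.keys r \<subseteq> {m'. mdeg m' < mdeg m}"
      and orth: "\<And>m'. mdeg m' < mdeg m \<Longrightarrow> \<phi> (monom m' * (monom m - r)) = 0"
      using inner.ex_projection[OF finite_mdeg_less, of "mdeg m" "monom m"] by auto
    \<comment> \<open>The projection \<open>r\<close> may have complex coefficients. Monomials are
      real, so by \<open>phi_pstar\<close> the conjugate of \<open>r\<close> satisfies the same
      orthogonality conditions; these are affine in \<open>r\<close>, and the average is a real
      solution.\<close>
    define r' where "r' = cst (1/2) * (r + pstar r)"
    have "r' \<in> deg_less (mdeg m)"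
      using r by (auto simp: r'_def deg_less_def lookup_add in_keys_iff subset_iff)
        (metis add.right_neutral complex_cnj_zero)
    moreover have "pstar r' = r'"
      by (simp add: r'_def pstar_scale pstar_add add.commute)
    moreover have "\<phi> (monom m' * (monom m - r')) = 0" if "mdeg m' < mdeg m" for m'
    proof -
      have "\<phi> (monom m' * (monom m - pstar r)) = cnj (\<phi> (monom m' * (monom m - r)))"
        by (simp add: phi_pstar[symmetric] pstar_mult pstar_diff)
      then have *: "\<phi> (monom m' * (monom m - pstar r)) = 0" by (simp add: orth that)
      have "monom m - r' = cst (1/2) * (monom m - r) + cst (1/2) * (monom m - pstar r)"
        by (rule poly_mapping_eqI) (simp add: r'_def lookup_minus lookup_add, simp add: field_simps)
      then have "\<phi> (monom m' * (monom m - r')) =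
          \<phi> (cst (1/2) * (monom m' * (monom m - r)) + cst (1/2) * (monom m' * (monom m - pstar r)))"
        by (simp add: distrib_left mult.left_commute)
      also have "\<dots> = 0" using orth[OF that] * by (simp only: phi_add phi_scale) simp
      finally show ?thesis .
    qed
    ultimately show ?thesis by blast
  qed
  then obtain r where r: "\<And>m. r m \<in> deg_less (mdeg m)" "\<And>m. pstar (r m) = r m"
    "\<And>m m'. mdeg m' < mdeg m \<Longrightarrow> \<phi> (monom m' * (monom m - r m)) = 0" for m :: "'d \<Rightarrow>\<^sub>0 nat"
    by metis
  define P where "P = lin_ext (\<lambda>m. monom m - r m)"
  have lin: "plinear P" unfolding P_def by (rule plinear_lin_ext)
  have "orth_poly \<phi> P"
  proof
    show "plinear P" by (rule lin)
    show "P q - q \<in> deg_less n" if "q \<in> deg_less (Suc n)" for q n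
      using that
    proof (rule deg_less_closure)
      fix q q' :: "'d mpoly"
      assume "P q - q \<in> deg_less n" "P q' - q' \<in> deg_less n"
      then show "P (q + q') - (q + q') \<in> deg_less n"
        using deg_less_add[of "P q - q" n "P q' - q'"]
        by (simp add: plinear_add[OF lin] algebra_simps)
    next
      fix c and m :: "'d \<Rightarrow>\<^sub>0 nat" assume "mdeg m < Suc n"
      then have "cst (- c) * r m \<in> deg_less n"
        using r(1)[of m] by (auto intro: deg_less_scale deg_less_mono)
      moreover have "P (cst c * monom m) = cst c * (monom m - r m)"
        by (simp only: plinear_scale[OF lin]) (simp add: P_def)
      ultimately show "P (cst c * monom m) - cst c * monom m \<in> deg_less n"
        by (simp add: right_diff_distrib single_uminus)
    qed (simp add: plinear_zero[OF lin])
    show "\<phi> (pstar v * P (hom n q)) = 0" if "v \<in> deg_less n" for v n q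
    proof (rule inner.semi_form_eq_0_if_monom)
      fix m' assume m': "m' \<in> Poly_Mapping.keys v"
      then have m': "mdeg m' < n" using that by (auto simp: deg_less_def in_keys_iff)
      show "\<phi> (pstar (monom m') * P (hom n q)) = 0"
      proof (rule mpoly_closure[of _ q], goal_cases)
        case (3 m)
        have "P (monom m) = monom m - r m" by (simp add: P_def)
        then show ?case using r(3)[of m' m] m'
          by (simp add: plinear_scale[OF lin] plinear_scale[OF plinear_restr] plinear_zero[OF lin]
              inner.scale[of "monom m'", simplified])
      qed (simp_all add: plinear_add[OF lin] plinear_add[OF plinear_restr] plinear_zero[OF lin]
          plinear_zero[OF plinear_restr] phi_add distrib_left)
    qed
    show "P (pstar q) = pstar (P q)" for q
      by (rule mpoly_closure[of _ q])
        (simp_all add: pstar_add plinear_add[OF lin] plinear_zero[OF lin] pstar_scale plinear_scale[OF lin]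
          pstar_diff r(2), simp add: P_def pstar_diff r(2))
  qed
  then show ?thesis by blast
qed

section \<open>Three-diagonal operators on polynomials\<close>

lemma funpow_comm: "(\<And>x. f (g x) = g (f x)) \<Longrightarrow> f ((g ^^ n) x) = (g ^^ n) (f x)"
  by (induction n) simp_all

text \<open>The extra factor commutes past the blocks in front of its own and is absorbed there;
  distinctness guarantees that there is only one such block.\<close>

lemma foldr_funpow_step:
  assumes comm: "\<And>i j x. f i (f j x) = f j (f i x)" and "distinct l" "k \<in> set l"
  shows "f k (foldr (\<lambda>j. f j ^^ n j) l v) = foldr (\<lambda>j. f j ^^ (if j = k then Suc (n j) else n j)) l v"
  using assms(2,3)
proof (induction l)
  case (Cons a l)
  show ?case
  proof (cases "a = k")
    case True
    then have "foldr (\<lambda>j. f j ^^ (if j = k then Suc (n j) else n j)) l v = foldr (\<lambda>j. f j ^^ n j) l v"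
      using Cons.prems by (intro foldr_cong) auto
    then show ?thesis using True by simp
  next
    case False
    then show ?thesis using Cons by (simp add: funpow_comm[of "f k" "f a", OF comm])
  qed
qed simp

text \<open>\<open>A0\<close> preserves the degree exactly. \<open>Am\<close> is pinned down by its
  matrix elements only: on degree \<open>n\<close> it may have components of any degree, those
  outside degree \<open>n - 1\<close> being null.\<close>

locale interacting = semi_form B for B :: "'d::{finite,linorder} mpoly \<Rightarrow> 'd mpoly \<Rightarrow> complex" +
  fixes A0 Am :: "'d \<Rightarrow> 'd mpoly \<Rightarrow> 'd mpoly"
  assumes graded: "mdeg m \<noteq> mdeg m' \<Longrightarrow> B (monom m) (monom m') = 0"
    and A0_linear: "plinear (A0 j)" and Am_linear: "plinear (Am j)"
    and A0_hom: "hom n (A0 j q) = A0 j (hom n q)"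
    and A0_sym: "B (A0 j q) r = B q (A0 j r)"
    and Am_adj: "B (pvar j * q) r = B q (Am j r)"
    and B_one: "B 1 1 = 1"
begin

definition X :: "'d \<Rightarrow> 'd mpoly \<Rightarrow> 'd mpoly" where
  "X j q = pvar j * q + A0 j q + Am j q"

lemma X_sym: "B (X j q) r = B q (X j r)"
  using herm[of "Am j q" r] herm[of q "pvar j * r"]
  by (simp add: X_def add add_left A0_sym Am_adj)

lemma X_linear: "plinear (X j)"
  by (simp add: plinear_def X_def plinear_add[OF A0_linear] plinear_add[OF Am_linear]
      plinear_scale[OF A0_linear] plinear_scale[OF Am_linear] distrib_left mult.left_commute[of "pvar j"])

lemma orth_if_mdeg_disjoint:
  assumes "\<And>m m'. m \<in> Poly_Mapping.keys q \<Longrightarrow> m' \<in> Poly_Mapping.keys r \<Longrightarrow> mdeg m \<noteq> mdeg m'"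
  shows "B q r = 0"
proof (rule semi_form_eq_0_if_monom)
  fix m assume m: "m \<in> Poly_Mapping.keys q"
  show "B (monom m) r = 0"
    by (rule mpoly_closure[of _ r]) (use m in \<open>simp_all add: add scale graded assms\<close>)
qed

definition ordered_word :: "('d \<Rightarrow> nat) \<Rightarrow> 'd mpoly" where
  "ordered_word n = foldr (\<lambda>j. X j ^^ n j) (sorted_list_of_set UNIV) 1"

end

text \<open>Commutativity is kept apart from \<open>interacting\<close> because the definition of
  the moments ranges over all choices of annihilators, whereas commutation is given for one choice
  only.\<close>

locale interacting_comm = interacting +
  assumes X_comm: "X i (X j q) = X j (X i q)"
begin

definition T :: "'a mpoly \<Rightarrow> 'a mpoly" where
  "T = lin_ext (\<lambda>m. ordered_word (Poly_Mapping.lookup m))"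

lemma T_linear: "plinear T"
  unfolding T_def by (rule plinear_lin_ext)

lemma T_monom: "T (monom m) = ordered_word (Poly_Mapping.lookup m)"
  by (simp add: T_def)

lemma T_one: "T 1 = 1"
proof -
  have "foldr (\<lambda>j. X j ^^ 0) l q = q" for l :: "'a list" and q
    by (induction l) simp_all
  then show ?thesis using T_monom[of 0] by (simp add: ordered_word_def)
qed

text \<open>This is where commutativity enters: \<open>X j\<close> has to travel to its own block in
  the ordered word.\<close>

lemma T_pvar_mult: "T (pvar j * q) = X j (T q)"
proof -
  have "plinear (\<lambda>q. T (pvar j * q))" "plinear (\<lambda>q. X j (T q))"
    by (simp_all add: plinear_def plinear_add[OF T_linear] plinear_scale[OF T_linear]
        plinear_add[OF X_linear] plinear_scale[OF X_linear] distrib_left mult.left_commute[of "pvar j"])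
  then show ?thesis
  proof (rule plinear_eqI)
    fix m :: "'a \<Rightarrow>\<^sub>0 nat"
    have "X j (ordered_word (Poly_Mapping.lookup m)) =
        foldr (\<lambda>i. X i ^^ (if i = j then Suc (Poly_Mapping.lookup m i) else Poly_Mapping.lookup m i))
          (sorted_list_of_set UNIV) 1"
      unfolding ordered_word_def by (rule foldr_funpow_step) (simp_all add: X_comm)
    also have "(\<lambda>i. X i ^^ (if i = j then Suc (Poly_Mapping.lookup m i) else Poly_Mapping.lookup m i)) =
        (\<lambda>i. X i ^^ Poly_Mapping.lookup (Poly_Mapping.single j (Suc 0) + m) i)"
      by (auto simp: fun_eq_iff lookup_add lookup_single when_def)
    finally show "T (pvar j * monom m) = X j (T (monom m))"
      by (simp add: monom_Cons[symmetric] T_monom ordered_word_def)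
  qed
qed

text \<open>Each \<open>X j\<close> is symmetric, so the left polynomial can be moved to the right
  one variable at a time, scalars being conjugated on the way.\<close>

lemma B_T_T: "B (T q) (T r) = B 1 (T (pstar q * r))"
proof (induction q arbitrary: r rule: mpoly_induct)
  case (pvar j q)
  have "B (T (pvar j * q)) (T r) = B (T q) (T (pvar j * r))"
    by (simp add: T_pvar_mult X_sym)
  also have "\<dots> = B 1 (T (pstar (pvar j * q) * r))"
    by (simp add: pvar pstar_pvar_mult mult.assoc mult.left_commute)
  finally show ?case .
qed (simp_all add: T_one add_left scale_left scale pstar_add pstar_scale distrib_right mult.assoc
    plinear_add[OF T_linear] plinear_scale[OF T_linear] add)

end

locale realization = interacting_comm B A0 Am + orth_poly \<phi> P
  for B :: "'d::{finite,linorder} mpoly \<Rightarrow> 'd mpoly \<Rightarrow> complex" and A0 Am \<phi> P +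
  assumes moments: "\<phi> q = B 1 (T q)"
begin

text \<open>
  Modulo null vectors \<open>pvar j * q\<close> is some \<open>T w\<close>. Both \<open>T w\<close> and \<open>T (P (pvar j * q))\<close> are orthogonal
  to everything of degree at most \<open>k\<close>, whereas their difference \<open>T u\<close> comes from a polynomial of degree at
  most \<open>k\<close>; so \<open>T u\<close> is orthogonal to itself.
\<close>

lemma T_P_equiv_step:
  assumes IH: "\<And>v s. v \<in> deg_less (Suc k) \<Longrightarrow> B s v = B s (T (P v))" and m: "mdeg m = k"
  shows "B s (pvar j * monom m) = B s (T (P (pvar j * monom m)))"
proof -
  define q where "q = monom m"
  \<comment> \<open>\<open>Am j q\<close> may have components of degree above \<open>k\<close>, out
    of reach of \<open>IH\<close>. Truncation discards only null vectors.\<close>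
  define h where "h = restr {m. mdeg m < Suc k} (Am j q)"
  \<comment> \<open>Obtained by solving \<open>X j q = pvar j * q + A0 j q + Am j q\<close> for
    \<open>pvar j * q\<close> and replacing, by \<open>IH\<close>, every vector of degree at most
    \<open>k\<close> by its image under \<open>T\<close> and \<open>P\<close>.\<close>
  define w where "w = pvar j * P q - P (A0 j q) - P h"
  define u where "u = w - P (pvar j * q)"
  have q: "q \<in> deg_less (Suc k)" by (simp add: q_def m)
  have xq: "pvar j * q \<in> deg_less (Suc (Suc k))" using q by (rule pvar_mult_deg_less)
  have A0q: "A0 j q \<in> deg_less (Suc k)"
  proof -
    have "hom k (A0 j q) = A0 j q" by (simp add: A0_hom q_def m)
    then show ?thesis by (metis deg_less_hom)
  qed
  have h: "h \<in> deg_less (Suc k)" by (auto simp: h_def deg_less_def split: if_splits)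
  have Am: "B s (Am j q) = B s h" for s
  proof -
    define s1 where "s1 = restr {m. mdeg m < Suc k} s"
    define s2 where "s2 = s - s1"
    have "B s1 (Am j q - h) = 0"
      by (rule orth_if_mdeg_disjoint) (auto simp: s1_def h_def in_keys_iff lookup_minus split: if_splits)
    moreover have "B s2 h = 0"
      by (rule orth_if_mdeg_disjoint) (auto simp: s1_def s2_def h_def in_keys_iff lookup_minus split: if_splits)
    moreover have "B (pvar j * s2) q = 0"
    proof (rule orth_if_mdeg_disjoint)
      fix m1 m2 assume "m1 \<in> Poly_Mapping.keys (pvar j * s2)" "m2 \<in> Poly_Mapping.keys q"
      then obtain m3 where "m1 = Poly_Mapping.single j 1 + m3" "m3 \<in> Poly_Mapping.keys s2" "m2 = m"
        using keys_mult[of "pvar j" s2] by (auto simp: pvar_def q_def)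
      then show "mdeg m1 \<noteq> mdeg m2"
        using m by (auto simp: s1_def s2_def in_keys_iff lookup_minus split: if_splits)
    qed
    ultimately have "B (s1 + s2) (Am j q) = B (s1 + s2) h"
      by (simp add: diff add_left Am_adj)
    then show ?thesis by (simp add: s2_def)
  qed
  have Tw: "B s (pvar j * q) = B s (T w)" for s
  proof -
    have "pvar j * q = X j q - A0 j q - Am j q" by (simp add: X_def)
    then have "B s (pvar j * q) = B (X j s) q - B s (A0 j q) - B s (Am j q)"
      by (simp add: diff X_sym)
    also have "\<dots> = B (X j s) (T (P q)) - B s (T (P (A0 j q))) - B s (T (P h))"
      using IH[OF q] IH[OF A0q] IH[OF h] Am by simp
    also have "\<dots> = B s (T w)"
      by (simp add: w_def X_sym T_pvar_mult[symmetric] plinear_diff[OF T_linear] diff)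
    finally show ?thesis .
  qed
  \<comment> \<open>The leading part \<open>pvar j * q\<close> is common to
    \<open>pvar j * P q\<close> and \<open>P (pvar j * q)\<close> and cancels.\<close>
  have u: "u \<in> deg_less (Suc k)"
  proof -
    have "u = pvar j * (P q - q) - (P (pvar j * q) - pvar j * q) - P (A0 j q) - P h"
      by (simp add: u_def w_def algebra_simps)
    then show ?thesis
      using pvar_mult_deg_less[OF P_lower[OF q], of j] P_lower[OF xq] P_deg_less[OF A0q] P_deg_less[OF h]
      by (simp add: deg_less_diff)
  qed
  have "B (T v) (T u) = 0" if v: "v \<in> deg_less (Suc k)" for v
  proof -
    \<comment> \<open>With \<open>v\<close> in the form \<open>P v'\<close> the hypothesis
      \<open>IH\<close> can be read backwards: \<open>T v\<close> becomes \<open>v'\<close>, which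
      the grading separates from \<open>pvar j * q\<close>.\<close>
    obtain v' where v': "v' \<in> deg_less (Suc k)" "P v' = v" using P_onto[OF v] by blast
    have "B (T v) (T w) = B v' (pvar j * q)"
      using Tw[of "T v"] IH[OF v'(1), of "pvar j * q"] herm[of "T v" "pvar j * q"]
        herm[of v' "pvar j * q"] v'(2) by simp
    also have "\<dots> = 0"
      by (rule orth_if_mdeg_disjoint)
        (use v'(1) in \<open>auto simp: deg_less_def in_keys_iff q_def m monom_Cons[symmetric] lookup_single when_def split: if_splits\<close>)
    finally have "B (T v) (T w) = 0" .
    moreover have "B (T v) (T (P (pvar j * q))) = 0"
      using P_orth[OF v, of "pvar j * q"]
      by (simp add: B_T_T moments[symmetric] q_def m monom_Cons[symmetric])
    ultimately show ?thesis by (simp add: u_def plinear_diff[OF T_linear] diff)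
  qed
  from null(1)[OF this[OF u]] have "B s (T u) = 0" .
  then show ?thesis
    using Tw[of s] by (simp add: u_def q_def plinear_diff[OF T_linear] diff)
qed

lemma T_P_equiv: "q \<in> deg_less n \<Longrightarrow> B s q = B s (T (P q))"
proof (induction n arbitrary: q s)
  case 0
  then show ?case using deg_less_0D[of q] by (simp add: plinear_zero[OF P_linear] plinear_zero[OF T_linear])
next
  case (Suc n)
  show ?case
  proof (rule deg_less_closure[OF Suc.prems])
    fix c and m :: "'d \<Rightarrow>\<^sub>0 nat" assume "mdeg m < Suc n"
    then consider "mdeg m < n" | "n = 0" "mdeg m = 0" | k where "n = Suc k" "mdeg m = n"
      by (cases n) (auto simp: less_Suc_eq)
    then have "B s (monom m) = B s (T (P (monom m)))"
    proof cases
      case 1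
      then show ?thesis by (intro Suc.IH) simp
    next
      case 2
      then have "m = 0" by (intro poly_mapping_eqI) (simp add: mdeg_def)
      then show ?thesis by (simp add: P_one T_one)
    next
      case (3 k)
      then have "mdeg m = Suc k" by simp
      then obtain j m' where m: "m = Poly_Mapping.single j (Suc 0) + m'" "mdeg m' = k"
        by (rule exponent_cases)
      have "B s (pvar j * monom m') = B s (T (P (pvar j * monom m')))"
        by (rule T_P_equiv_step[OF _ m(2)]) (use Suc.IH 3 in blast)
      then show ?thesis by (simp add: m(1) monom_Cons)
    qed
    then show "B s (cst c * monom m) = B s (T (P (cst c * monom m)))"
      by (simp add: scale plinear_scale[OF P_linear] plinear_scale[OF T_linear])
  qed (simp_all add: add plinear_add[OF P_linear] plinear_add[OF T_linear]
      plinear_zero[OF P_linear] plinear_zero[OF T_linear])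
qed

lemma T_P_equiv': "B s q = B s (T (P q))" "B q s = B (T (P q)) s"
proof -
  show *: "B s q = B s (T (P q))" for s q
    using T_P_equiv deg_less_ex by blast
  show "B q s = B (T (P q)) s"
    using *[of s q] herm[of q s] herm[of "T (P q)" s] by simp
qed

lemma B_determined: "B q r = \<phi> (pstar (P q) * P r)"
proof -
  have "B q r = B (T (P q)) r" by (rule T_P_equiv')
  also have "\<dots> = B (T (P q)) (T (P r))" by (rule T_P_equiv')
  finally show ?thesis by (simp add: moments B_T_T)
qed

text \<open>Equivalence modulo null vectors can be used only in an argument of the form, so
  \<open>X j\<close> is moved to the left while \<open>r\<close> is replaced, and back
  afterwards.\<close>

lemma B_X_determined: "B q (X j r) = \<phi> (pstar (P q) * (pvar j * P r))"
proof -
  have "B q (X j r) = B (T (P q)) (X j r)" by (rule T_P_equiv')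
  also have "\<dots> = B (X j (T (P q))) r" by (rule X_sym[symmetric])
  also have "\<dots> = B (X j (T (P q))) (T (P r))" by (rule T_P_equiv')
  also have "\<dots> = B (T (P q)) (T (pvar j * P r))" by (simp add: X_sym T_pvar_mult)
  finally show ?thesis by (simp add: moments B_T_T)
qed

end

section \<open>Symmetric tensors as polynomials\<close>

primrec expo :: "'d list \<Rightarrow> 'd \<Rightarrow>\<^sub>0 nat" where
  "expo [] = 0"
| "expo (x # xs) = Poly_Mapping.single x (Suc 0) + expo xs"

lemma lookup_expo: "Poly_Mapping.lookup (expo xs) j = count (mset xs) j"
  by (induction xs) (auto simp: lookup_add lookup_single when_def)

lemma expo_eq_iff: "expo xs = expo ys \<longleftrightarrow> mset xs = mset ys"
  by (auto simp: poly_mapping_eq_iff fun_eq_iff lookup_expo multiset_eq_iff)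

lemma mdeg_expo [simp]: "mdeg (expo xs) = length xs"
  by (induction xs) simp_all

lemma ex_expo: "\<exists>xs. expo xs = (m :: 'd::finite \<Rightarrow>\<^sub>0 nat)"
proof (induction m rule: exponent_induct)
  case zero
  show ?case by (rule exI[of _ "[]"]) simp
next
  case (single j m)
  then show ?case using expo.simps(2) by metis
qed

text \<open>The rearrangements of one word. Their number is the multinomial coefficient of
  \<open>m\<close>.\<close>

definition orb :: "('d \<Rightarrow>\<^sub>0 nat) \<Rightarrow> 'd list set" where
  "orb m = {xs. expo xs = m}"

lemma finite_orb [simp]: "finite (orb (m :: 'd::finite \<Rightarrow>\<^sub>0 nat))"
  by (rule finite_subset[OF _ finite_lists_length_eq[of UNIV "mdeg m"]]) (auto simp: orb_def)

lemma card_orb [simp]: "card (orb (m :: 'd::finite \<Rightarrow>\<^sub>0 nat)) \<noteq> 0"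
proof -
  obtain xs where "expo xs = m" using ex_expo by blast
  then have "xs \<in> orb m" by (simp add: orb_def)
  then show ?thesis using finite_orb[of m] by auto
qed

lemma symmetrize_permute_list:
  assumes "\<tau> permutes {..<length xs}"
  shows "symmetrize F (permute_list \<tau> xs) = symmetrize F xs"
proof -
  have "(\<Sum>\<sigma> | \<sigma> permutes {..<length xs}. F (permute_list \<sigma> (permute_list \<tau> xs))) =
      (\<Sum>\<sigma> | \<sigma> permutes {..<length xs}. F (permute_list (\<tau> \<circ> \<sigma>) xs))"
    by (intro sum.cong refl) (simp add: permute_list_compose)
  also have "\<dots> = (\<Sum>\<sigma> | \<sigma> permutes {..<length xs}. F (permute_list \<sigma> xs))"
    by (rule setum_permutations_compose_left[OF assms, symmetric])
  finally show ?thesis by (simp add: symmetrize_def)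
qed

text \<open>No stabilizers have to be counted: every permutation maps the orbit bijectively to
  itself, so summing the symmetrization over the orbit and exchanging the sums yields
  \<open>fact (length xs)\<close> copies of the orbit sum.\<close>

lemma symmetrize_average:
  fixes F :: "'d::finite tensor"
  shows "of_nat (card (orb (expo xs))) * symmetrize F xs = (\<Sum>ys\<in>orb (expo xs). F ys)"
proof -
  let ?O = "orb (expo xs)" and ?S = "{\<sigma>. \<sigma> permutes {..<length xs}}"
  have len: "length ys = length xs" if "ys \<in> ?O" for ys
    using that mset_eq_length by (auto simp: orb_def expo_eq_iff)
  have const: "symmetrize F ys = symmetrize F xs" if "ys \<in> ?O" for ys
  proof -
    have "mset ys = mset xs" using that by (simp add: orb_def expo_eq_iff)
    then obtain \<tau> where "\<tau> permutes {..<length xs}" "permute_list \<tau> xs = ys"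
      by (rule mset_eq_permutation)
    then show ?thesis using symmetrize_permute_list by metis
  qed
  have inner: "(\<Sum>ys\<in>?O. F (permute_list \<sigma> ys)) = (\<Sum>ys\<in>?O. F ys)" if "\<sigma> \<in> ?S" for \<sigma>
  proof -
    have perm: "\<sigma> permutes {..<length ys}" if "ys \<in> ?O" for ys
      using \<open>\<sigma> \<in> ?S\<close> len[OF that] by simp
    have inj: "inj_on (permute_list \<sigma>) ?O"
    proof (rule inj_onI)
      fix ys zs assume *: "ys \<in> ?O" "zs \<in> ?O" "permute_list \<sigma> ys = permute_list \<sigma> zs"
      have "permute_list (inv \<sigma>) (permute_list \<sigma> ys) = ys" if "ys \<in> ?O" for ys
        using permute_list_compose[of "inv \<sigma>" ys \<sigma>] perm[OF that]
        by (simp add: permutes_inv permutes_inv_o)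
      then show "ys = zs" using * by metis
    qed
    moreover have "permute_list \<sigma> ` ?O \<subseteq> ?O"
      using perm by (auto simp: orb_def expo_eq_iff)
    ultimately have "permute_list \<sigma> ` ?O = ?O"
      using endo_inj_surj finite_orb by blast
    then show ?thesis using sum.reindex[OF inj, of F] by simp
  qed
  have "of_nat (card ?O) * symmetrize F xs = (\<Sum>ys\<in>?O. symmetrize F ys)"
    by (simp add: const)
  also have "\<dots> = (\<Sum>ys\<in>?O. (\<Sum>\<sigma>\<in>?S. F (permute_list \<sigma> ys))) / fact (length xs)"
    by (simp add: symmetrize_def len sum_divide_distrib)
  also have "(\<Sum>ys\<in>?O. (\<Sum>\<sigma>\<in>?S. F (permute_list \<sigma> ys))) = (\<Sum>\<sigma>\<in>?S. \<Sum>ys\<in>?O. F ys)"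
    by (subst sum.swap) (simp add: inner)
  also have "\<dots> = fact (length xs) * (\<Sum>ys\<in>?O. F ys)"
    by (simp add: card_permutations[of "{..<length xs}" "length xs"] of_nat_fact)
  finally show ?thesis by simp
qed

text \<open>
  The normalization makes the commutative product with a variable correspond to the symmetrized
  tensor product.
\<close>

definition tens :: "'d mpoly \<Rightarrow> 'd tensor" where
  "tens q = (\<lambda>xs. Poly_Mapping.lookup q (expo xs) / of_nat (card (orb (expo xs))))"

lemma tens_add: "tens (q + r) = tens q + tens r"
  and tens_diff: "tens (q - r) = tens q - tens r"
  and tens_zero [simp]: "tens 0 = 0"
  and tens_scale: "tens (cst c * q) = cscale c (tens q)"
  by (simp_all add: tens_def cscale_def fun_eq_iff lookup_add lookup_minus add_divide_distrib diff_divide_distrib)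

lemma tens_sum: "tens (sum f I) = (\<Sum>i\<in>I. tens (f i))"
  by (induction I rule: infinite_finite_induct) (simp_all add: tens_add)

lemma tens_eq_iff [simp]: "tens q = tens r \<longleftrightarrow> q = (r :: 'd::finite mpoly)"
proof
  assume eq: "tens q = tens r"
  show "q = r"
  proof (rule poly_mapping_eqI)
    fix m :: "'d \<Rightarrow>\<^sub>0 nat"
    obtain xs where "expo xs = m" using ex_expo by blast
    then show "Poly_Mapping.lookup q m = Poly_Mapping.lookup r m"
      using fun_cong[OF eq, of xs] by (simp add: tens_def)
  qed
qed simp

lemma tens_eq_0_iff [simp]: "tens q = 0 \<longleftrightarrow> q = (0 :: 'd::finite mpoly)"
  using tens_eq_iff[of q 0] by simp

lemma hom_part_tens: "hom_part n (tens q) = tens (hom n q)"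
  by (auto simp: hom_part_def tens_def fun_eq_iff)

lemma hom_tens_sym_pow: "tens (hom n q) \<in> sym_pow n"
  by (auto simp: sym_pow_def tens_def expo_eq_iff[symmetric] dest: arg_cong[of _ _ mdeg])

lemma tens_fock: "tens q \<in> (fock :: 'd::finite tensor set)"
proof -
  obtain n where n: "q \<in> deg_less n" using deg_less_ex by blast
  have "{k. hom k q \<noteq> 0} \<subseteq> {..<n}" using hom_eq_0_deg_less[OF n] by (auto simp: linorder_not_le[symmetric])
  then show ?thesis
    by (auto simp: fock_def hom_part_tens hom_tens_sym_pow intro: finite_subset)
qed

lemma sym_pow_length: "F \<in> sym_pow n \<Longrightarrow> length xs \<noteq> n \<Longrightarrow> F xs = 0"
  and sym_pow_mset: "F \<in> sym_pow n \<Longrightarrow> mset xs = mset ys \<Longrightarrow> F xs = F ys"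
  unfolding sym_pow_def by blast+

lemma fock_imp_tens:
  fixes F :: "'d::finite tensor"
  assumes "F \<in> fock"
  shows "\<exists>q. F = tens q"
proof -
  have F: "hom_part n F \<in> sym_pow n" for n using assms by (simp add: fock_def)
  obtain N where N: "\<And>n. hom_part n F \<noteq> 0 \<Longrightarrow> n < N"
    using assms finite_nat_bounded[of "{n. hom_part n F \<noteq> 0}"] by (auto simp: fock_def)
  have sym: "F xs = F ys" if "expo xs = expo ys" for xs ys
  proof -
    have "mset xs = mset ys" "length xs = length ys"
      using that mset_eq_length by (auto simp: expo_eq_iff)
    moreover from this have "hom_part (length xs) F xs = hom_part (length xs) F ys"
      using sym_pow_mset[OF F] by blast
    ultimately show ?thesis by (simp add: hom_part_def)
  qed
  \<comment> \<open>This undoes the normalization of \<open>tens\<close>; by \<open>sym\<close> any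
    word with exponent \<open>m\<close> gives the same value.\<close>
  define g where "g m = of_nat (card (orb m)) * F (SOME xs. expo xs = m)" for m
  have g: "g (expo xs) = of_nat (card (orb (expo xs))) * F xs" for xs
    using sym[OF someI[of "\<lambda>ys. expo ys = expo xs" xs]] by (simp add: g_def)
  have "mdeg m < N" if "g m \<noteq> 0" for m
  proof -
    obtain xs where xs: "expo xs = m" using ex_expo by blast
    with that g[of xs] have "F xs \<noteq> 0" by auto
    then have "hom_part (length xs) F \<noteq> 0" by (auto simp: hom_part_def fun_eq_iff)
    with N show ?thesis using xs by auto
  qed
  then have "finite {m. g m \<noteq> 0}"
    using finite_subset[OF _ finite_mdeg_less[of N], of "{m. g m \<noteq> 0}"] by auto
  then have "F = tens (Poly_Mapping.Abs_poly_mapping g)"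
    by (auto simp: tens_def fun_eq_iff g)
  then show ?thesis ..
qed

lemma fock_iff: "(F :: 'd::finite tensor) \<in> fock \<longleftrightarrow> (\<exists>q. F = tens q)"
  using fock_imp_tens[of F] tens_fock by auto

lemma hom_part_sym_pow: "F \<in> sym_pow n \<Longrightarrow> hom_part k F = (if k = n then F else 0)"
  by (auto simp: hom_part_def fun_eq_iff sym_pow_length)

lemma sym_pow_iff: "F \<in> sym_pow n \<longleftrightarrow> (\<exists>q. F = tens (hom n q))"
proof
  assume F: "F \<in> sym_pow n"
  have "0 \<in> sym_pow k" for k by (simp add: sym_pow_def)
  then have "F \<in> fock" using F
    by (auto simp: fock_def hom_part_sym_pow intro: finite_subset[of _ "{n}"])
  then obtain q where "F = tens q" using fock_imp_tens by blast
  then show "\<exists>q. F = tens (hom n q)"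
    using hom_part_sym_pow[OF F, of n] hom_part_tens by metis
qed (auto simp: hom_tens_sym_pow)

lemma tens_one: "tens 1 = (vacuum :: 'd::finite tensor)"
proof -
  have expo_0: "expo xs = 0 \<longleftrightarrow> xs = []" for xs :: "'d list"
    using expo_eq_iff[of xs "[]"] by auto
  then have "orb (0 :: 'd \<Rightarrow>\<^sub>0 nat) = {[]}" by (auto simp: orb_def)
  then show ?thesis by (auto simp: tens_def vacuum_def fun_eq_iff expo_0 lookup_one)
qed

lemma lookup_pvar_mult:
  "Poly_Mapping.lookup (pvar j * q) m =
    (if Poly_Mapping.lookup m j = 0 then 0 else Poly_Mapping.lookup q (m - Poly_Mapping.single j (Suc 0)))"
proof (induction q rule: mpoly_closure)
  case (3 k)
  have "Poly_Mapping.single j (Suc 0) + k = m \<longleftrightarrow>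
      Poly_Mapping.lookup m j \<noteq> 0 \<and> k = m - Poly_Mapping.single j (Suc 0)"
  proof
    assume "Poly_Mapping.lookup m j \<noteq> 0 \<and> k = m - Poly_Mapping.single j (Suc 0)"
    then show "Poly_Mapping.single j (Suc 0) + k = m"
      by (intro poly_mapping_eqI) (auto simp: lookup_add lookup_minus lookup_single when_def)
  qed (auto simp: lookup_add)
  then show ?case
    by (auto simp: mult.left_commute[of "pvar j"] monom_Cons[symmetric] lookup_single when_def)
qed (simp_all add: distrib_left lookup_add)

section \<open>The symmetric product as a product of polynomials\<close>

definition lin_poly :: "complex ^ 'd \<Rightarrow> 'd::finite mpoly" where
  "lin_poly u = (\<Sum>j\<in>UNIV. cst (u $ j) * pvar j)"

lemma lin_poly_axis [simp]: "lin_poly (axis j 1) = pvar j"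
proof -
  have "lin_poly (axis j 1) = (\<Sum>k\<in>UNIV. if k = j then pvar k else 0)"
    unfolding lin_poly_def by (rule sum.cong) (auto simp: axis_def)
  then show ?thesis by simp
qed

lemma lin_poly_add: "lin_poly (u + v) = lin_poly u + lin_poly v"
  by (simp add: lin_poly_def single_add distrib_right sum.distrib)

lemma lin_poly_scale: "lin_poly (c *s u) = cst c * lin_poly u"
  by (simp add: lin_poly_def sum_distrib_left cst_mult_cst)

lemma lin_poly_mult: "lin_poly u * q = (\<Sum>j\<in>UNIV. cst (u $ j) * (pvar j * q))"
  by (simp add: lin_poly_def sum_distrib_right mult.assoc)

lemma hom_lin_poly_mult: "hom (Suc n) (lin_poly u * q) = lin_poly u * hom n q"
  by (simp add: lin_poly_mult plinear_sum[OF plinear_restr] plinear_scale[OF plinear_restr] hom_pvar_mult)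

lemma sum_orb_Cons:
  fixes f :: "'d::finite list \<Rightarrow> complex"
  assumes "f [] = 0"
  shows "(\<Sum>ys\<in>orb m. f ys) =
    (\<Sum>j\<in>UNIV. \<Sum>zs\<in>{zs. Poly_Mapping.single j (Suc 0) + expo zs = m}. f (j # zs))"
proof -
  let ?A = "\<lambda>j. {zs. Poly_Mapping.single j (Suc 0) + expo zs = m}"
  have fin: "finite (?A j)" for j
    by (rule finite_subset[OF _ finite_lists_length_le[of UNIV "mdeg m"]]) auto
  have "(\<Sum>ys\<in>orb m. f ys) = (\<Sum>ys\<in>(\<Union>j. (#) j ` ?A j). f ys)"
  proof (rule sum.mono_neutral_right)
    show "\<forall>i\<in>orb m - (\<Union>j. (#) j ` ?A j). f i = 0"
    proof
      fix ys assume "ys \<in> orb m - (\<Union>j. (#) j ` ?A j)"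
      then show "f ys = 0" using assms by (cases ys) (auto simp: orb_def)
    qed
  qed (auto simp: orb_def[symmetric], auto simp: orb_def)
  also have "\<dots> = (\<Sum>j\<in>UNIV. \<Sum>ys\<in>(#) j ` ?A j. f ys)"
    by (rule sum.UNION_disjoint) (auto simp: fin)
  also have "\<dots> = (\<Sum>j\<in>UNIV. \<Sum>zs\<in>?A j. f (j # zs))"
    by (simp add: sum.reindex)
  finally show ?thesis .
qed

text \<open>Group the rearrangements by their first letter \<open>j\<close>. The remaining words
  form a single orbit or none, and over an orbit the normalization of \<open>tens q\<close> sums up
  to the plain coefficient of \<open>q\<close>.\<close>

lemma sym_prod_tens: "sym_prod u (tens q) = tens (lin_poly u * q)"
proof
  fix xs :: "'a list"
  define m where "m = expo xs"
  have "(\<Sum>zs | Poly_Mapping.single j (Suc 0) + expo zs = m. tens q zs) =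
      Poly_Mapping.lookup (pvar j * q) m" for j
  proof (cases "Poly_Mapping.lookup m j = 0")
    case True
    then have none: "Poly_Mapping.single j (Suc 0) + expo zs \<noteq> m" for zs
      by (auto simp: lookup_add)
    show ?thesis using True by (simp add: none lookup_pvar_mult)
  next
    case False
    define m' where "m' = m - Poly_Mapping.single j (Suc 0)"
    have "Poly_Mapping.single j (Suc 0) + m' = m"
      using False by (intro poly_mapping_eqI) (auto simp: m'_def lookup_add lookup_minus lookup_single when_def)
    then have "{zs. Poly_Mapping.single j (Suc 0) + expo zs = m} = orb m'"
      by (auto simp: orb_def)
    moreover have "(\<Sum>zs\<in>orb m'. tens q zs) = (\<Sum>zs\<in>orb m'. Poly_Mapping.lookup q m' / of_nat (card (orb m')))"
      by (rule sum.cong) (auto simp: orb_def tens_def)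
    ultimately show ?thesis using False by (simp add: lookup_pvar_mult m'_def[symmetric])
  qed
  then have "(\<Sum>ys\<in>orb m. tensor_left u (tens q) ys) =
      (\<Sum>j\<in>UNIV. u $ j * Poly_Mapping.lookup (pvar j * q) m)"
    by (subst sum_orb_Cons) (simp_all add: sum_distrib_left[symmetric])
  also have "\<dots> = Poly_Mapping.lookup (lin_poly u * q) m"
    by (simp add: lin_poly_def sum_distrib_right lookup_sum mult.assoc)
  finally have "of_nat (card (orb m)) * sym_prod u (tens q) xs = Poly_Mapping.lookup (lin_poly u * q) m"
    by (simp add: sym_prod_def symmetrize_average m_def)
  then show "sym_prod u (tens q) xs = tens (lin_poly u * q) xs"
    by (simp add: tens_def m_def[symmetric] field_simps)
qed

lemma creator_tens: "creator (axis j 1) (tens q) = tens (pvar j * q)"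
  by (simp add: creator_def sym_prod_tens)

section \<open>Transfer between the Fock space and polynomials\<close>

lemma pre_scalar_productD:
  assumes "pre_scalar_product H b"
  shows "f \<in> H \<Longrightarrow> g \<in> H \<Longrightarrow> h \<in> H \<Longrightarrow> b f (g + h) = b f g + b f h"
    and "f \<in> H \<Longrightarrow> g \<in> H \<Longrightarrow> b f (cscale c g) = c * b f g"
    and "f \<in> H \<Longrightarrow> g \<in> H \<Longrightarrow> b g f = cnj (b f g)"
    and "f \<in> H \<Longrightarrow> b f f \<in> \<real>\<^sub>\<ge>\<^sub>0"
  using assms unfolding pre_scalar_product_def by blast+

lemma pre_scalar_product_semi_form:
  assumes "pre_scalar_product (sym_pow n) b"
  shows "semi_form (\<lambda>q r. b (tens (hom n q)) (tens (hom n r)))"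
proof
  fix f g h :: "'a mpoly" and c
  note b = pre_scalar_productD[OF assms] and tens = hom_tens_sym_pow
  show "b (tens (hom n f)) (tens (hom n (g + h))) = b (tens (hom n f)) (tens (hom n g)) + b (tens (hom n f)) (tens (hom n h))"
    by (simp add: b(1)[OF tens tens tens] plinear_add[OF plinear_restr] tens_add)
  show "b (tens (hom n f)) (tens (hom n (cst c * g))) = c * b (tens (hom n f)) (tens (hom n g))"
    by (simp add: b(2)[OF tens tens] plinear_scale[OF plinear_restr] tens_scale)
  show "b (tens (hom n g)) (tens (hom n f)) = cnj (b (tens (hom n f)) (tens (hom n g)))"
    by (rule b(3)[OF tens tens])
  show "b (tens (hom n f)) (tens (hom n f)) \<in> \<real>\<^sub>\<ge>\<^sub>0"
    by (rule b(4)[OF tens])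
qed

lemma fock_kernel_pre_scalar_product:
  assumes "fock_kernel \<Omega>"
  shows "pre_scalar_product (sym_pow n) (ip \<Omega> n)"
proof (cases n)
  case 0
  then show ?thesis
    by (auto simp: pre_scalar_product_def cscale_def algebra_simps nonneg_Reals_iff
        complex_norm_square[symmetric] mult.commute[of "cnj _"])
next
  case (Suc k)
  then show ?thesis using assms by (auto simp: fock_kernel_def)
qed

text \<open>Only the pre-scalar products are assumed, so the locale is also available for the kernel
  of a state before its annihilators are constructed.\<close>

locale fock_forms =
  fixes \<Omega> :: "'d::{finite,linorder} kernel_seq"
  assumes psp: "\<And>n. pre_scalar_product (sym_pow n) (ip \<Omega> n)"
begin

definition fform :: "'d mpoly \<Rightarrow> 'd mpoly \<Rightarrow> complex" where
  "fform q r = fock_ip \<Omega> (tens q) (tens r)"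

text \<open>The range of the sum in \<open>fock_ip\<close> depends on the left argument. A common
  bound for several polynomials gives them the same range, and the laws of a form follow
  termwise.\<close>

lemma fform_sum:
  assumes "q \<in> deg_less N"
  shows "fform q r = (\<Sum>n<N. ip \<Omega> n (tens (hom n q)) (tens (hom n r)))"
proof -
  have "{n. hom n q \<noteq> 0} \<subseteq> {..<N}"
    using hom_eq_0_deg_less[OF assms] by (auto simp: linorder_not_le[symmetric])
  then show ?thesis
    unfolding fform_def fock_ip_def hom_part_tens tens_eq_0_iff
    using semi_form.zero_left[OF pre_scalar_product_semi_form[OF psp], of _ _]
    by (intro sum.mono_neutral_left)
      (auto, metis (no_types, lifting) hom_hom plinear_restr plinear_zero tens_zero)
qed

sublocale semi_form fform
proof
  fix f g h :: "'d mpoly" and c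
  obtain N where "f \<in> deg_less N" "g \<in> deg_less N"
    using deg_less_ex[of f] deg_less_ex[of g] deg_less_mono by (meson nle_le)
  note sums = fform_sum[OF this(1)] fform_sum[OF this(2)]
  note forms = pre_scalar_product_semi_form[OF psp]
  show "fform f (g + h) = fform f g + fform f h"
    by (simp add: sums semi_form.add[OF forms] sum.distrib)
  show "fform f (cst c * g) = c * fform f g"
    by (simp add: sums semi_form.scale[OF forms] sum_distrib_left)
  show "fform g f = cnj (fform f g)"
    unfolding sums cnj_sum by (intro sum.cong refl semi_form.herm[OF forms])
  show "fform f f \<in> \<real>\<^sub>\<ge>\<^sub>0"
    using semi_form.pos[OF forms] by (auto simp: sums nonneg_Reals_iff intro!: sum_nonneg)
qed

lemma fform_hom: "fform (hom n q) r = ip \<Omega> n (tens (hom n q)) (tens (hom n r))"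
proof -
  have "fform (hom n q) r = (\<Sum>k<Suc n. ip \<Omega> k (tens (hom k (hom n q))) (tens (hom k r)))"
    by (rule fform_sum[OF deg_less_hom])
  also have "\<dots> = ip \<Omega> n (tens (hom n q)) (tens (hom n r)) +
      (\<Sum>k<n. ip \<Omega> k (tens (hom k (hom n q))) (tens (hom k r)))"
    by simp
  also have "(\<Sum>k<n. ip \<Omega> k (tens (hom k (hom n q))) (tens (hom k r))) = 0"
  proof (rule sum.neutral, rule ballI)
    fix k assume "k \<in> {..<n}"
    then have "hom k (hom n q) = hom k 0" by (simp add: plinear_zero[OF plinear_restr])
    then show "ip \<Omega> k (tens (hom k (hom n q))) (tens (hom k r)) = 0"
      using semi_form.zero_left[OF pre_scalar_product_semi_form[OF psp], of k r] by metis
  qed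
  finally show ?thesis by simp
qed

lemma fform_hom_orth:
  assumes "n \<noteq> k"
  shows "fform (hom n q) (hom k r) = 0"
proof -
  have "hom n (hom k r) = hom n 0" using assms by (simp add: plinear_zero[OF plinear_restr])
  then show ?thesis
    using semi_form.zero[OF pre_scalar_product_semi_form[OF psp], of n q] by (metis fform_hom)
qed

end

section \<open>Operators on the Fock space carried over to polynomials\<close>

definition pull :: "'d list oper \<Rightarrow> 'd::finite mpoly \<Rightarrow> 'd mpoly" where
  "pull A q = inv tens (A (tens q))"

lemma tens_pull:
  assumes "linear_oper fock A"
  shows "tens (pull A q) = A (tens q)"
proof -
  have "A (tens q) \<in> fock" using assms by (auto simp: tens_fock linear_oper_def)
  then have "A (tens q) \<in> range tens" using fock_imp_tens by blast
  then show ?thesis by (simp add: pull_def f_inv_into_f)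
qed

lemma plinear_pull:
  fixes A :: "'d::finite list oper"
  assumes "linear_oper fock A"
  shows "plinear (pull A)"
proof -
  have "tens (pull A (q + r)) = tens (pull A q + pull A r)"
    "tens (pull A (cst c * q)) = tens (cst c * pull A q)" for q r :: "'d mpoly" and c
    using assms
    by (simp_all add: tens_fock tens_pull[OF assms] tens_add tens_scale linear_oper_def)
  then show ?thesis by (simp add: plinear_def)
qed

lemma hom_part_oper_sum:
  assumes "linear_oper (sym_pow n) (A n)" "F \<in> fock"
  shows "hom_part n (oper_sum A F) = A n (hom_part n F)"
proof
  fix xs
  have "A n (hom_part n F) \<in> sym_pow n"
    using assms by (auto simp: linear_oper_def fock_def)
  then show "hom_part n (oper_sum A F) xs = A n (hom_part n F) xs"
    using sym_pow_length[of "A n (hom_part n F)" n xs] by (auto simp: hom_part_def oper_sum_def)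
qed

lemma linear_oper_zero:
  assumes "linear_oper H A" "0 \<in> H"
  shows "A 0 = 0"
proof -
  have "cscale 0 f = 0" for f :: "'a \<Rightarrow> complex" by (simp add: cscale_def fun_eq_iff)
  moreover have "A (cscale 0 0) = cscale 0 (A 0)" using assms unfolding linear_oper_def by blast
  ultimately show ?thesis by metis
qed

lemma linear_oper_sum:
  fixes A :: "nat \<Rightarrow> 'd::finite list oper"
  assumes A: "\<And>n. linear_oper (sym_pow n) (A n)"
  shows "linear_oper fock (oper_sum A)"
  unfolding linear_oper_def
proof (intro conjI ballI allI)
  fix F assume F: "F \<in> (fock :: 'd tensor set)"
  then have Fn: "hom_part n F \<in> sym_pow n" for n by (simp add: fock_def)
  have "A n 0 = 0" for n
    by (rule linear_oper_zero[OF A]) (simp add: sym_pow_def)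
  then have "{n. hom_part n (oper_sum A F) \<noteq> 0} \<subseteq> {n. hom_part n F \<noteq> 0}"
    by (auto simp: hom_part_oper_sum[where A = A, OF A F])
  then show "oper_sum A F \<in> fock"
    using A F Fn by (auto simp: fock_def hom_part_oper_sum[where A = A, OF A F] linear_oper_def intro: finite_subset)
  show "oper_sum A (cscale c F) = cscale c (oper_sum A F)" for c
  proof
    fix xs :: "'d list"
    have "hom_part (length xs) (cscale c F) = cscale c (hom_part (length xs) F)"
      by (auto simp: hom_part_def cscale_def)
    then show "oper_sum A (cscale c F) xs = cscale c (oper_sum A F) xs"
      using A Fn by (simp add: oper_sum_def linear_oper_def cscale_def)
  qed
  fix G assume "G \<in> (fock :: 'd tensor set)"
  then have Gn: "hom_part n G \<in> sym_pow n" for n by (simp add: fock_def)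
  show "oper_sum A (F + G) = oper_sum A F + oper_sum A G"
  proof
    fix xs :: "'d list"
    have "hom_part (length xs) (F + G) = hom_part (length xs) F + hom_part (length xs) G"
      by (auto simp: hom_part_def)
    then show "oper_sum A (F + G) xs = (oper_sum A F + oper_sum A G) xs"
      using A Fn Gn by (simp add: oper_sum_def linear_oper_def)
  qed
qed

locale fock_operators =
  fixes \<Omega> :: "'d::{finite,linorder} kernel_seq" and a0 :: "'d \<Rightarrow> nat \<Rightarrow> 'd list oper"
    and am :: "'d \<Rightarrow> 'd list oper"
  assumes kernel: "fock_kernel \<Omega>"
    and a0_self_adjoint: "self_adjoint (sym_pow n) (ip \<Omega> n) (a0 j n)"
    and annihilators: "annihilators \<Omega> am"
begin

sublocale fock_forms \<Omega>
  by unfold_locales (rule fock_kernel_pre_scalar_product[OF kernel])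

lemma a0_linear: "linear_oper (sym_pow n) (a0 j n)"
  and a0_adjoint: "F \<in> sym_pow n \<Longrightarrow> G \<in> sym_pow n \<Longrightarrow> ip \<Omega> n (a0 j n F) G = ip \<Omega> n F (a0 j n G)"
  using a0_self_adjoint by (auto simp: self_adjoint_def is_adjoint_def)

lemma am_linear: "linear_oper fock (am j)"
  using annihilators by (auto simp: annihilators_def is_adjoint_def)

abbreviation "pa0 \<equiv> \<lambda>j. pull (oper_sum (a0 j))"
abbreviation "pam \<equiv> \<lambda>j. pull (am j)"

lemmas tens_pa0 = tens_pull[OF linear_oper_sum[OF a0_linear]]
lemmas tens_pam = tens_pull[OF am_linear]

lemma tens_hom_pa0: "tens (hom n (pa0 j q)) = a0 j n (tens (hom n q))"
  using hom_part_oper_sum[where A = "a0 j" and n = n, OF a0_linear tens_fock, of q]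
  by (simp add: hom_part_tens[symmetric] tens_pa0)

sublocale interacting fform pa0 pam
proof
  show "fform (monom m) (monom m') = 0" if "mdeg m \<noteq> mdeg m'" for m m'
    using fform_hom_orth[OF that, of "monom m" "monom m'"] by simp
  show "plinear (pa0 j)" for j by (rule plinear_pull[OF linear_oper_sum[OF a0_linear]])
  show "plinear (pam j)" for j by (rule plinear_pull[OF am_linear])
  show hom_pa0: "hom n (pa0 j q) = pa0 j (hom n q)" for n j q
  proof -
    have "hom k (hom n (pa0 j q)) = hom k (pa0 j (hom n q))" for k
    proof (cases "k = n")
      case True
      then have "tens (hom k (hom n (pa0 j q))) = tens (hom k (pa0 j (hom n q)))"
        by (simp add: tens_hom_pa0)
      then show ?thesis by simp
    next
      case False
      have "tens (hom k (pa0 j (hom n q))) = a0 j k 0"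
        using False by (simp add: tens_hom_pa0)
      also have "\<dots> = 0" by (rule linear_oper_zero[OF a0_linear]) (simp add: sym_pow_def)
      finally show ?thesis using False by simp
    qed
    then show ?thesis by (rule hom_eqI)
  qed
  show "fform (pa0 j q) r = fform q (pa0 j r)" for j q r
  proof -
    obtain N where "q \<in> deg_less N" "pa0 j q \<in> deg_less N"
      using deg_less_ex[of q] deg_less_ex[of "pa0 j q"] deg_less_mono by (meson nle_le)
    then show ?thesis
      by (simp add: fform_sum tens_hom_pa0 a0_adjoint hom_tens_sym_pow)
  qed
  show "fform (pvar j * q) r = fform q (pam j r)" for j q r
    using annihilators
    by (auto simp: tens_fock fform_def annihilators_def is_adjoint_def tens_pam creator_tens[symmetric])
  have "hom 0 (1 :: 'd mpoly) = 1" using hom_monom[of 0 0] by simp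
  then show "fform 1 1 = 1" using fform_hom[of 0 1 1]
    by (simp add: tens_one) (simp add: vacuum_def)
qed

lemma X_hat_tens: "X_hat a0 am j (tens q) = tens (X j q)"
  by (simp add: X_hat_def X_def creator_tens tens_add tens_pa0 tens_pam)

lemma word_tens:
  "foldr (\<lambda>j. X_hat a0 am j ^^ n j) l (tens q) = tens (foldr (\<lambda>j. X j ^^ n j) l q)"
proof (induction l)
  case (Cons a l)
  have "(X_hat a0 am a ^^ k) (tens r) = tens ((X a ^^ k) r)" for k r
    by (induction k) (simp_all add: X_hat_tens)
  then show ?case by (simp add: Cons)
qed simp

lemma moment_ordered_word:
  "fock_ip \<Omega> vacuum (foldr (\<lambda>j. X_hat a0 am j ^^ n j) (sorted_list_of_set UNIV) vacuum) =
    fform 1 (ordered_word n)"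
  by (simp add: fform_def ordered_word_def word_tens tens_one[symmetric])

text \<open>Within one degree the creator and the annihilator contribute nothing, as either matrix
  element pairs degree \<open>Suc n\<close> with degree \<open>n\<close>. Hence \<open>a0\<close>
  can be read off from \<open>X\<close>.\<close>

lemma fform_X_hom:
  "fform (hom n q) (X j (hom n r)) = ip \<Omega> n (tens (hom n q)) (a0 j n (tens (hom n r)))"
proof -
  have "fform (pvar j * hom n s) (hom n t) = 0" for s t
    using fform_hom_orth[of "Suc n" n "pvar j * s" t] by (simp add: hom_pvar_mult)
  from this[of q r] this[of r q] have "fform (hom n q) (pam j (hom n r)) = 0" "fform (hom n q) (pvar j * hom n r) = 0"
    using herm[of "hom n q" "pvar j * hom n r"] by (simp_all add: Am_adj)
  then show ?thesis
    by (simp add: X_def add A0_hom[symmetric] fform_hom tens_hom_pa0)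
qed

end

text \<open>Moving a factor onto the test vector \<open>s\<close> replaces one choice of
  annihilators by the other, since \<open>Am_adj\<close> expresses both by the creator. The test
  vector is arbitrary in the induction because it changes with every factor.\<close>

lemma (in interacting) moments_independent_of_annihilators:
  assumes "interacting B A0 Am'"
  shows "B s (interacting.ordered_word A0 Am' n) = B s (ordered_word n)"
proof -
  interpret other: interacting B A0 Am' by (rule assms)
  have X: "B s (other.X j q) = B (X j s) q" for s j q
    by (simp add: other.X_def X_def add add_left A0_sym other.Am_adj[symmetric] Am_adj[symmetric])
      (metis Am_adj herm)
  have pow: "(\<And>s. B s q = B s r) \<Longrightarrow> B s ((other.X j ^^ k) q) = B s ((X j ^^ k) r)" for q r s j k
    by (induction k arbitrary: s) (simp_all add: X, simp add: X_sym)
  have "B s (foldr (\<lambda>j. other.X j ^^ n j) l 1) = B s (foldr (\<lambda>j. X j ^^ n j) l 1)" for l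
    by (induction l arbitrary: s) (simp_all add: pow)
  then show ?thesis by (simp add: ordered_word_def other.ordered_word_def)
qed

locale three_diagonal_fock = fock_operators +
  assumes diag: "three_diagonal \<Omega> a0 am"
begin

sublocale interacting_comm fform pa0 pam
proof
  fix i j q
  have "X_hat a0 am i (X_hat a0 am j (tens q)) = X_hat a0 am j (X_hat a0 am i (tens q))"
    using diag tens_fock[of q] unfolding three_diagonal_def Let_def by blast
  then show "X i (X j q) = X j (X i q)" by (simp add: X_hat_tens)
qed

end

lemma same_moments_if:
  assumes "three_diagonal_fock \<Omega> a0 am"
    and "\<And>m. \<phi> (monom m) = fock_forms.fform \<Omega> 1 (interacting_comm.T (\<lambda>j. pull (oper_sum (a0 j))) (\<lambda>j. pull (am j)) (monom m))"
  shows "same_moments \<phi> \<Omega> a0"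
  unfolding same_moments_def
proof (intro allI impI)
  fix am' and n :: "'a \<Rightarrow> nat" assume am': "annihilators \<Omega> am'"
  interpret three_diagonal_fock \<Omega> a0 am by (rule assms(1))
  interpret other: fock_operators \<Omega> a0 am'
    by unfold_locales (rule kernel a0_self_adjoint am')+
  define m where "m = Poly_Mapping.Abs_poly_mapping n"
  have m: "Poly_Mapping.lookup m = n" by (simp add: m_def)
  have "\<phi> (\<Prod>j\<in>UNIV. pvar j ^ n j) = \<phi> (monom m)" by (simp add: monom_prod_pvar m)
  also have "\<dots> = fform 1 (ordered_word n)" by (simp add: assms(2) T_monom m)
  also have "\<dots> = fform 1 (other.ordered_word n)"
    by (rule moments_independent_of_annihilators[symmetric]) unfold_locales
  also have "\<dots> = fock_ip \<Omega> vacuum (foldr (\<lambda>j. X_hat a0 am' j ^^ n j) (sorted_list_of_set UNIV) vacuum)"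
    by (rule other.moment_ordered_word[symmetric])
  finally show "\<phi> (\<Prod>j\<in>UNIV. pvar j ^ n j) = \<dots>" .
qed

lemma (in three_diagonal_fock) same_moments_monom:
  assumes "same_moments \<phi> \<Omega> a0"
  shows "\<phi> (monom m) = fform 1 (T (monom m))"
proof -
  have "\<phi> (monom m) = fform 1 (ordered_word (Poly_Mapping.lookup m))"
    using assms annihilators unfolding same_moments_def monom_prod_pvar
    by (auto simp: moment_ordered_word)
  then show ?thesis by (simp add: T_monom)
qed

text \<open>\<open>W\<close> stands for evaluation at the operators \<open>Y\<close> applied to the
  vacuum. It will be \<open>T\<close> for a given pair and the inverse of \<open>P\<close> for the
  pair of a state.\<close>

lemma tens_mem_orbit:
  fixes W :: "'d::finite mpoly \<Rightarrow> 'd mpoly"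
  assumes W: "plinear W" "W 1 = 1" "\<And>j q. tens (W (pvar j * q)) = Y j (tens (W q))"
    and q: "0 \<in> S" "\<And>m. Poly_Mapping.lookup q m \<in> S"
  shows "tens (W q) \<in> orbit_of S Y"
proof -
  have mono: "\<exists>A\<in>gen_algebra S Y. A vacuum = tens (W (monom m))" for m
  proof (induction m rule: exponent_induct)
    case zero
    show ?case using W(2) gen_algebra.one by (auto intro!: bexI[of _ id] simp: tens_one)
  next
    case (single j m)
    then obtain A where A: "A \<in> gen_algebra S Y" "A vacuum = tens (W (monom m))" by blast
    then show ?case
      by (intro bexI[of _ "Y j \<circ> A"] gen_algebra.mult gen_algebra.gen) (simp_all add: monom_Cons W(3))
  qed
  have scaled: "\<exists>A\<in>gen_algebra S Y. A vacuum = tens (W (cst c * monom m))" if "c \<in> S" for c m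
  proof -
    obtain A where "A \<in> gen_algebra S Y" "A vacuum = tens (W (monom m))" using mono by blast
    then show ?thesis
      by (intro bexI[of _ "\<lambda>F. cscale c (A F)"] gen_algebra.scale that)
        (simp_all add: plinear_scale[OF W(1)] tens_scale)
  qed
  have "\<exists>A\<in>gen_algebra S Y. A vacuum = tens (W q)"
  proof (rule mpoly_closure[of _ q])
    show "\<exists>A\<in>gen_algebra S Y. A vacuum = tens (W 0)"
      using scaled[OF q(1), of 0] by simp
    fix r s
    assume "\<exists>A\<in>gen_algebra S Y. A vacuum = tens (W r)" "\<exists>A\<in>gen_algebra S Y. A vacuum = tens (W s)"
    then obtain A A' where "A \<in> gen_algebra S Y" "A vacuum = tens (W r)"
      "A' \<in> gen_algebra S Y" "A' vacuum = tens (W s)" by blast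
    then show "\<exists>A\<in>gen_algebra S Y. A vacuum = tens (W (r + s))"
      by (intro bexI[of _ "\<lambda>F. A F + A' F"] gen_algebra.add) (simp_all add: plinear_add[OF W(1)] tens_add)
  qed (rule scaled[OF q(2)])
  then obtain A where "A \<in> gen_algebra S Y" "tens (W q) = A vacuum" by metis
  then show ?thesis by (simp add: orbit_of_def)
qed

lemma gen_algebra_preserves:
  assumes "A \<in> gen_algebra S Y" "F \<in> K"
    and "\<And>F G. F \<in> K \<Longrightarrow> G \<in> K \<Longrightarrow> F + G \<in> K" "\<And>c F. c \<in> S \<Longrightarrow> F \<in> K \<Longrightarrow> cscale c F \<in> K"
    and "\<And>j F. F \<in> K \<Longrightarrow> Y j F \<in> K"
  shows "A F \<in> K"
  using assms(1,2) by (induction A arbitrary: F rule: gen_algebra.induct) (simp_all add: assms(3-))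

section \<open>Uniqueness of the pair\<close>

context three_diagonal_fock
begin

lemma realization_if_same_moments:
  assumes "orth_poly \<phi> P" "same_moments \<phi> \<Omega> a0"
  shows "realization fform pa0 pam \<phi> P"
proof -
  interpret orth_poly \<phi> P by (rule assms)
  show ?thesis
  proof
    show "\<phi> q = fform 1 (T q)" for q
      by (rule mpoly_closure[of _ q])
        (simp_all add: plinear_zero[OF T_linear] plinear_add[OF T_linear] plinear_scale[OF T_linear]
          phi_add phi_scale add scale same_moments_monom[OF assms(2)])
  qed
qed

lemma ip_determined:
  assumes "orth_poly \<phi> P" "same_moments \<phi> \<Omega> a0"
  shows "ip \<Omega> n (tens (hom n q)) (tens (hom n r)) = \<phi> (pstar (P (hom n q)) * P (hom n r))"
    and "ip \<Omega> n (tens (hom n q)) (a0 j n (tens (hom n r))) =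
      \<phi> (pstar (P (hom n q)) * (pvar j * P (hom n r)))"
proof -
  interpret realization fform pa0 pam \<phi> P by (rule realization_if_same_moments[OF assms])
  show "ip \<Omega> n (tens (hom n q)) (tens (hom n r)) = \<phi> (pstar (P (hom n q)) * P (hom n r))"
    using fform_hom[of n q "hom n r"] B_determined by simp
  show "ip \<Omega> n (tens (hom n q)) (a0 j n (tens (hom n r))) =
      \<phi> (pstar (P (hom n q)) * (pvar j * P (hom n r)))"
    using fform_X_hom[of n q j r] B_X_determined by simp
qed

end

lemma induces_3_diagonalE:
  assumes "induces_3_diagonal \<Omega> a0"
  obtains am where "three_diagonal_fock \<Omega> a0 am"
  using assms unfolding induces_3_diagonal_def
  by (auto simp: three_diagonal_fock_def fock_operators_def three_diagonal_fock_axioms_def)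

lemma
  fixes F G :: "'d::finite tensor"
  assumes "F \<in> sym_pow n" "G \<in> sym_pow n"
  shows sym_pow_add: "F + G \<in> sym_pow n" and sym_pow_diff: "F - G \<in> sym_pow n"
proof -
  obtain q r where FG: "F = tens (hom n q)" "G = tens (hom n r)"
    using assms sym_pow_iff[of F n] sym_pow_iff[of G n] by auto
  have "F + G = tens (hom n (q + r))" "F - G = tens (hom n (q - r))"
    unfolding FG by (simp_all only: tens_add tens_diff plinear_add[OF plinear_restr] plinear_diff[OF plinear_restr])
  then show "F + G \<in> sym_pow n" "F - G \<in> sym_pow n" by (simp_all only: hom_tens_sym_pow)
qed

lemma psp_diff:
  fixes F G D :: "'d::finite tensor"
  assumes b: "pre_scalar_product (sym_pow n) b" and F: "F \<in> sym_pow n" "G \<in> sym_pow n" "D \<in> sym_pow n"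
  shows "b D (F - G) = b D F - b D G"
  using pre_scalar_productD(1)[OF b F(3) sym_pow_diff[OF F(1,2)] F(2)] by simp

lemma fock_kernel_mem:
  assumes "fock_kernel \<Omega>" "h \<in> sym_pow n"
  shows "\<Omega> (Suc n) u v h \<in> sym_pow n"
proof -
  have "\<Omega> (Suc n) u v \<in> La (sym_pow n) (ip \<Omega> n)"
    using assms(1) unfolding fock_kernel_def pd_kernel_def by simp
  then show ?thesis using assms(2) unfolding La_def linear_oper_def by blast
qed

lemma pair_eq_if_same_moments:
  fixes \<phi> :: "'d::{finite,linorder} mpoly \<Rightarrow> complex"
  assumes "is_state \<phi>" and "induces_3_diagonal \<Omega> a0" "same_moments \<phi> \<Omega> a0"
    and "induces_3_diagonal \<Omega>' a0'" "same_moments \<phi> \<Omega>' a0'"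
  shows "pair_eq \<Omega> a0 \<Omega>' a0'"
proof -
  \<comment> \<open>Chosen from the state before either pair is looked at, so both pairs are
    measured by the same \<open>P\<close>.\<close>
  obtain P where P: "orth_poly \<phi> P" using ex_orth_poly assms(1) by blast
  obtain am where am: "three_diagonal_fock \<Omega> a0 am" using assms(2) by (rule induces_3_diagonalE)
  obtain am' where am': "three_diagonal_fock \<Omega>' a0' am'" using assms(4) by (rule induces_3_diagonalE)
  interpret one: three_diagonal_fock \<Omega> a0 am by (rule am)
  interpret two: three_diagonal_fock \<Omega>' a0' am' by (rule am')
  have ip: "ip \<Omega> n F G = ip \<Omega>' n F G" if "F \<in> sym_pow n" "G \<in> sym_pow n" for n F G
    using that by (auto simp: sym_pow_iff one.ip_determined[OF P assms(3)] two.ip_determined[OF P assms(5)])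
  have a0_ip: "ip \<Omega> n F (a0 j n G) = ip \<Omega>' n F (a0' j n G)" if "F \<in> sym_pow n" "G \<in> sym_pow n" for n F G j
    using that by (auto simp: sym_pow_iff one.ip_determined[OF P assms(3)] two.ip_determined[OF P assms(5)])
  \<comment> \<open>The test vector is the difference \<open>F - G\<close> itself; since the two
    products agree, equal matrix elements make its norm zero.\<close>
  have null: "null_vec (ip \<Omega> n) (F - G)"
    if F: "F \<in> sym_pow n" "G \<in> sym_pow n" "ip \<Omega> n (F - G) F = ip \<Omega>' n (F - G) G" for n F G
    unfolding null_vec_def
    using psp_diff[OF one.psp F(1,2) sym_pow_diff[OF F(1,2)]] F(3) ip[OF sym_pow_diff[OF F(1,2)] F(2)]
    by simp
  have \<Omega>_mem: "\<Omega> (Suc n) u v h \<in> sym_pow n" "\<Omega>' (Suc n) u v h \<in> sym_pow n" if "h \<in> sym_pow n" for n u v h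
    using fock_kernel_mem[OF one.kernel that] fock_kernel_mem[OF two.kernel that] by blast+
  \<comment> \<open>The matrix elements of a kernel are values of the product one degree higher,
    which are already known to agree.\<close>
  have \<Omega>_ip: "ip \<Omega> n F (\<Omega> (Suc n) u v G) = ip \<Omega>' n F (\<Omega>' (Suc n) u v G)"
    if F: "F \<in> sym_pow n" and G: "G \<in> sym_pow n" for n F G u v
  proof -
    have prod: "sym_prod w H \<in> sym_pow (Suc n)" if H: "H \<in> sym_pow n" for w and H :: "'d tensor"
    proof -
      obtain q where "H = tens (hom n q)" using H sym_pow_iff[of H n] by auto
      moreover have "lin_poly w * hom n q = hom (Suc n) (lin_poly w * hom n q)"
        by (simp add: hom_lin_poly_mult)
      ultimately show ?thesis by (metis sym_prod_tens hom_tens_sym_pow)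
    qed
    have "ip \<Omega> n F (\<Omega> (Suc n) u v G) = ip \<Omega> (Suc n) (sym_prod u F) (sym_prod v G)"
      "ip \<Omega>' n F (\<Omega>' (Suc n) u v G) = ip \<Omega>' (Suc n) (sym_prod u F) (sym_prod v G)"
      using one.kernel two.kernel F G unfolding fock_kernel_def by metis+
    then show ?thesis by (simp only: ip[OF prod[OF F] prod[OF G]])
  qed
  have a0_mem: "a0 j n h \<in> sym_pow n" "a0' j n h \<in> sym_pow n" if "h \<in> sym_pow n" for j n h
    using one.a0_linear two.a0_linear that by (auto simp: linear_oper_def)
  show ?thesis
    unfolding pair_eq_def
  proof (intro conjI allI ballI)
    show "\<Omega> 0 u v z = \<Omega>' 0 u v z" if "z \<in> sym_pow 0" for u v z
      using one.kernel two.kernel that by (simp add: fock_kernel_def)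
    show "null_vec (ip \<Omega> n) (\<Omega> (Suc n) u v h - \<Omega>' (Suc n) u v h)" if "h \<in> sym_pow n" for n u v h
      using null \<Omega>_ip \<Omega>_mem sym_pow_diff that by meson
    show "null_vec (ip \<Omega> n) (a0 j n h - a0' j n h)" if "h \<in> sym_pow n" for j n h
      using null a0_ip a0_mem sym_pow_diff that by meson
  qed (rule ip)
qed

section \<open>The state of a pair\<close>

lemma (in three_diagonal_fock) real_orbit:
  assumes "real_poly q"
  shows "tens (T q) \<in> orbit_of \<real> (X_hat a0 am)"
  using assms by (intro tens_mem_orbit) (simp_all add: T_linear T_one T_pvar_mult X_hat_tens real_poly_def)

text \<open>Reality comes from the real orbit, which contains the vacuum and \<open>T q\<close> for
  real \<open>q\<close>. Positivity is \<open>B_T_T\<close>: the value at \<open>pstar q * q\<close>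
  is the norm square of \<open>T q\<close>. A linear functional is fixed by its values on monomials,
  hence uniqueness.\<close>

lemma ex1_state:
  fixes \<Omega> :: "'d::{finite,linorder} kernel_seq"
  assumes "induces_3_diagonal \<Omega> a0"
  shows "\<exists>!\<phi>. is_state \<phi> \<and> same_moments \<phi> \<Omega> a0"
proof -
  obtain am where am: "three_diagonal_fock \<Omega> a0 am" using assms by (rule induces_3_diagonalE)
  interpret three_diagonal_fock \<Omega> a0 am by (rule am)
  define \<phi> where "\<phi> q = fform 1 (T q)" for q
  have "\<phi> q \<in> \<real>" if "real_poly q" for q
  proof -
    have "real_poly 1" by (simp add: real_poly_iff_pstar)
    then have "tens 1 \<in> orbit_of \<real> (X_hat a0 am)" using real_orbit[of 1] by (simp add: T_one)
    then show ?thesis using diag real_orbit[OF that]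
      by (simp add: \<phi>_def fform_def three_diagonal_def Let_def)
  qed
  then have state: "is_state \<phi>"
    by (simp add: is_state_def mult_map_scale_conv_mult)
      (simp add: \<phi>_def plinear_add[OF T_linear] plinear_scale[OF T_linear] T_one add scale B_one
        B_T_T[symmetric] pos)
  have moments: "same_moments \<phi> \<Omega> a0"
    by (rule same_moments_if[OF am]) (simp add: \<phi>_def)
  show ?thesis
  proof (rule ex1I[of _ \<phi>])
    fix \<psi> :: "'d mpoly \<Rightarrow> complex" assume \<psi>: "is_state \<psi> \<and> same_moments \<psi> \<Omega> a0"
    interpret psi: state_form \<psi> by unfold_locales (use \<psi> in blast)
    interpret phi: state_form \<phi> by unfold_locales (rule state)
    have "\<psi> q = \<phi> q" for q
      by (rule mpoly_closure[of _ q])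
        (use \<psi> in \<open>simp_all add: psi.phi_add psi.phi_scale phi.phi_add phi.phi_scale same_moments_monom,
          simp add: \<phi>_def\<close>)
    then show "\<psi> = \<phi>" by blast
  qed (use state moments in blast)
qed

section \<open>The pair of a state\<close>

lemma inv_tens [simp]: "inv tens (tens q) = (q :: 'd::finite mpoly)"
  by (rule inv_f_f) (simp add: inj_def)

lemma sum_apply: "sum f I x = (\<Sum>i\<in>I. f i x :: complex)"
  by (induction I rule: infinite_finite_induct) simp_all

lemma linear_oper_sym_powI:
  assumes "plinear L" "\<And>q. A (tens (hom n q)) = tens (hom n (L (hom n q)))"
  shows "linear_oper (sym_pow n) A"
  unfolding linear_oper_def
proof (intro conjI ballI allI)
  fix F :: "'a tensor" assume "F \<in> sym_pow n"
  then obtain q where F: "F = tens (hom n q)" using sym_pow_iff[of F n] by auto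
  show "A F \<in> sym_pow n" by (simp add: F assms(2) hom_tens_sym_pow)
  show "A (cscale c F) = cscale c (A F)" for c
    by (simp add: F tens_scale[symmetric] plinear_scale[OF plinear_restr, symmetric] assms(2))
      (simp add: plinear_scale[OF plinear_restr] plinear_scale[OF assms(1)])
  fix G :: "'a tensor" assume "G \<in> sym_pow n"
  then obtain r where G: "G = tens (hom n r)" using sym_pow_iff[of G n] by auto
  show "A (F + G) = A F + A G"
    by (simp add: F G tens_add[symmetric] plinear_add[OF plinear_restr, symmetric] assms(2))
      (simp add: plinear_add[OF plinear_restr] plinear_add[OF assms(1)])
qed

text \<open>An adjoint makes preservation of null vectors automatic: the norm square of
  \<open>A F\<close> is the product of \<open>F\<close> with \<open>A' (A F)\<close>, which vanishes
  for null \<open>F\<close> by Cauchy-Schwarz.\<close>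

lemma La_if_is_adjoint:
  fixes b :: "'d::finite list form"
  assumes b: "pre_scalar_product (sym_pow n) b" and "linear_oper (sym_pow n) A"
    and adj: "is_adjoint (sym_pow n) b A A'"
  shows "A \<in> La (sym_pow n) b"
proof -
  interpret semi_form "\<lambda>q r. b (tens (hom n q)) (tens (hom n r))"
    by (rule pre_scalar_product_semi_form[OF b])
  have "null_vec b (A F)" if F: "F \<in> sym_pow n" "null_vec b F" for F
  proof -
    have mem: "A F \<in> sym_pow n" "A' (A F) \<in> sym_pow n"
      using assms(2) adj F(1) by (auto simp: is_adjoint_def linear_oper_def)
    then obtain q r where qr: "F = tens (hom n q)" "A' (A F) = tens (hom n r)"
      using F(1) sym_pow_iff[of F n] sym_pow_iff[of "A' (A F)" n] by auto
    have "b (A F) (A F) = b F (A' (A F))"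
      using adj F(1) mem(1) by (auto simp: is_adjoint_def)
    also have "\<dots> = 0" using null(2)[of q r] F(2) qr by (simp add: null_vec_def)
    finally show ?thesis by (simp add: null_vec_def)
  qed
  then show ?thesis using assms(2) adj by (auto simp: La_def)
qed

locale state_pair = orth_poly \<phi> P for \<phi> :: "'d::{finite,linorder} mpoly \<Rightarrow> complex" and P
begin

definition form :: "'d mpoly \<Rightarrow> 'd mpoly \<Rightarrow> complex" where
  "form q r = \<phi> (pstar (P q) * P r)"

definition mult_op :: "'d \<Rightarrow> 'd mpoly \<Rightarrow> 'd mpoly" where
  "mult_op j q = inv P (pvar j * P q)"

lemma P_inv [simp]: "P (inv P q) = q"
  using bij_P by (simp add: bij_is_surj surj_f_inv_f)

lemma inv_P [simp]: "inv P (P q) = q"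
  using bij_P by (simp add: bij_is_inj)

lemma P_mult_op [simp]: "P (mult_op j q) = pvar j * P q"
  by (simp add: mult_op_def)

lemma P_eqI: "P q = P r \<Longrightarrow> q = r"
  using inj_P by (rule injD)

lemma plinear_inv_P: "plinear (inv P)"
proof -
  have "P (inv P (q + r)) = P (inv P q + inv P r)" "P (inv P (cst c * q)) = P (cst c * inv P q)" for q r c
    by (simp_all add: plinear_add[OF P_linear] plinear_scale[OF P_linear])
  then show ?thesis unfolding plinear_def using P_eqI by blast
qed

lemma plinear_mult_op: "plinear (mult_op j)"
  by (simp add: plinear_def mult_op_def plinear_add[OF P_linear] plinear_scale[OF P_linear]
      plinear_add[OF plinear_inv_P] distrib_left plinear_scale[OF plinear_inv_P, symmetric]
      mult.left_commute[of "pvar j"])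

lemma mult_op_commute: "mult_op i (mult_op j q) = mult_op j (mult_op i q)"
  by (simp add: mult_op_def mult.left_commute)

lemma mult_op_pstar: "mult_op j (pstar q) = pstar (mult_op j q)"
  by (rule P_eqI) (simp add: P_real pstar_pvar_mult)

sublocale form: semi_form form
proof
  fix f g h c
  show "form f (g + h) = form f g + form f h"
    by (simp add: form_def plinear_add[OF P_linear] inner.add)
  show "form f (cst c * g) = c * form f g"
    by (simp add: form_def plinear_scale[OF P_linear] inner.scale)
  show "form g f = cnj (form f g)" unfolding form_def by (rule inner.herm)
  show "form f f \<in> \<real>\<^sub>\<ge>\<^sub>0" by (simp add: form_def inner.pos)
qed

lemma form_mult_op: "form (mult_op j q) r = form q (mult_op j r)"
  by (simp add: form_def pstar_pvar_mult mult.assoc mult.left_commute)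

lemma form_lower: "v \<in> deg_less n \<Longrightarrow> form v (hom n q) = 0"
  by (simp add: form_def P_deg_less P_orth)

lemma form_lower': "v \<in> deg_less n \<Longrightarrow> form (hom n q) v = 0"
  using form.herm[of "hom n q" v] by (simp add: form_lower)

lemma form_hom_orth: "n \<noteq> k \<Longrightarrow> form (hom n q) (hom k r) = 0"
  using form_lower[OF deg_less_mono[OF deg_less_hom], of n k q r]
    form_lower'[OF deg_less_mono[OF deg_less_hom], of k n q r]
  by (cases n k rule: linorder_cases) auto

lemma form_sum_hom:
  assumes "r \<in> deg_less N" "n < N"
  shows "form (hom n q) r = form (hom n q) (hom n r)"
proof -
  have "form (hom n q) r = (\<Sum>k<N. form (hom n q) (hom k r))"
    by (subst sum_hom[OF assms(1)]) (rule form.sum_right)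
  also have "\<dots> = (\<Sum>k<N. if k = n then form (hom n q) (hom n r) else 0)"
    by (rule sum.cong) (auto simp: form_hom_orth)
  finally show ?thesis using assms(2) by simp
qed

lemma form_hom: "form (hom n q) r = form (hom n q) (hom n r)"
proof -
  obtain N where "r \<in> deg_less N" using deg_less_ex by blast
  then have "r \<in> deg_less (N + Suc n)" by (rule deg_less_mono) simp
  then show ?thesis by (rule form_sum_hom) simp
qed

lemma form_hom': "form q (hom n r) = form (hom n q) (hom n r)"
  using form_hom[of n r q] form.herm[of q "hom n r"] form.herm[of "hom n q" "hom n r"] by simp

text \<open>\<open>P\<close> and its inverse keep leading parts, so conjugation by \<open>P\<close>
  does not affect the degree-raising part of multiplication: it is the creator exactly, not just
  modulo null vectors.\<close>

lemma mult_op_top: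
  "mult_op j (hom n q) - pvar j * hom n q \<in> deg_less (Suc n)"
proof -
  let ?v = "mult_op j (hom n q)" and ?q = "hom n q"
  have q: "P ?q - ?q \<in> deg_less n" by (rule P_lower[OF deg_less_hom])
  have "pvar j * P ?q \<in> deg_less (Suc (Suc n))"
    by (intro pvar_mult_deg_less P_deg_less deg_less_hom)
  then obtain w where w: "w \<in> deg_less (Suc (Suc n))" "P w = pvar j * P ?q"
    using P_onto by blast
  have "w = ?v" by (rule P_eqI) (simp add: w)
  then have v: "P ?v - ?v \<in> deg_less (Suc n)" using P_lower[OF w(1)] by simp
  have "?v - pvar j * ?q = pvar j * (P ?q - ?q) - (P ?v - ?v)"
    by (simp add: algebra_simps)
  then show ?thesis by (simp only: deg_less_diff[OF pvar_mult_deg_less[OF q] v])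
qed

text \<open>Creator and \<open>mult_op\<close> differ by terms too low to meet degree
  \<open>Suc n\<close>, and \<open>mult_op\<close> is symmetric. So the adjoint of the creator is a
  homogeneous component of \<open>mult_op\<close>.\<close>

lemma form_creation:
  "form (pvar j * hom n q) (hom (Suc n) r) = form (hom n q) (hom n (mult_op j (hom (Suc n) r)))"
proof -
  have "form (mult_op j (hom n q) - pvar j * hom n q) (hom (Suc n) r) = 0"
    by (rule form_lower[OF mult_op_top])
  then show ?thesis by (simp add: form.diff_left form_mult_op form_hom[symmetric])
qed

text \<open>
  For \<open>q\<close> of degree \<open>n\<close> the component of degree \<open>n\<close> of \<open>mult_op j (lin_poly v * q)\<close> comes from the
  annihilator alone, so \<open>kernel_poly n u v\<close> is \<open>a\<^sup>-(u) a\<^sup>+(v)\<close> on degree \<open>n\<close>.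
\<close>

definition kernel_poly :: "nat \<Rightarrow> (complex, 'd) vec \<Rightarrow> (complex, 'd) vec \<Rightarrow> 'd mpoly \<Rightarrow> 'd mpoly" where
  "kernel_poly n u v q = hom n (\<Sum>j\<in>UNIV. cst (cnj (u $ j)) * mult_op j (lin_poly v * q))"

lemma kernel_poly_linear: "plinear (kernel_poly n u v)"
proof -
  have *: "cst a * mult_op j (lin_poly v * (cst c * q)) = cst c * (cst a * mult_op j (lin_poly v * q))"
    for a c j q
    by (simp only: mult.left_commute[of "lin_poly v" "cst c" q] plinear_scale[OF plinear_mult_op]
        mult.left_commute[of "cst a" "cst c"])
  show ?thesis
    unfolding plinear_def kernel_poly_def *
    by (simp add: distrib_left plinear_add[OF plinear_mult_op] plinear_add[OF plinear_restr] sum.distrib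
        sum_distrib_left[symmetric] plinear_scale[OF plinear_restr])
qed

lemma hom_kernel_poly [simp]: "hom n (kernel_poly n u v q) = kernel_poly n u v q"
  by (simp add: kernel_poly_def)

lemma form_kernel_poly:
  "form (lin_poly u * hom n q) (lin_poly v * hom n r) = form (hom n q) (kernel_poly n u v (hom n r))"
proof -
  have *: "lin_poly v * hom n r = hom (Suc n) (lin_poly v * r)" by (simp add: hom_lin_poly_mult)
  have "form (lin_poly u * hom n q) (lin_poly v * hom n r) =
      (\<Sum>j\<in>UNIV. cnj (u $ j) * form (pvar j * hom n q) (lin_poly v * hom n r))"
    by (subst lin_poly_mult) (simp add: form.sum_left form.scale_left)
  also have "\<dots> = (\<Sum>j\<in>UNIV. cnj (u $ j) * form (hom n q) (mult_op j (lin_poly v * hom n r)))"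
    by (simp add: * form_creation form_hom[symmetric])
  also have "\<dots> = form (hom n q) (\<Sum>j\<in>UNIV. cst (cnj (u $ j)) * mult_op j (lin_poly v * hom n r))"
    by (simp add: form.sum_right form.scale)
  also have "\<dots> = form (hom n q) (kernel_poly n u v (hom n r))"
    unfolding kernel_poly_def by (rule form_hom)
  finally show ?thesis .
qed

section \<open>The kernels and the degree-preserving operators of a state\<close>

definition kernel :: "'d kernel_seq" where
  "kernel n = (case n of 0 \<Rightarrow> (\<lambda>u v z. z)
     | Suc k \<Rightarrow> (\<lambda>u v h. tens (kernel_poly k u v (inv tens h))))"

definition a0 :: "'d \<Rightarrow> nat \<Rightarrow> 'd list oper" where
  "a0 j n h = tens (hom n (mult_op j (inv tens h)))"

lemma kernel_0 [simp]: "kernel 0 u v z = z"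
  and kernel_Suc [simp]: "kernel (Suc n) u v (tens q) = tens (kernel_poly n u v q)"
  by (simp_all add: kernel_def)

text \<open>\<open>hom n (p j)\<close> is the partial derivative of \<open>hom (Suc n) q\<close> in
  the variable \<open>j\<close> divided by \<open>Suc n\<close>, and the second identity is Euler's.
  Both follow from the slice decomposition without computing multinomial coefficients.\<close>

lemma tens_slices:
  obtains p where "\<And>j. (\<lambda>xs. tens (hom (Suc n) q) (j # xs)) = tens (hom n (p j))"
    "hom (Suc n) q = (\<Sum>j\<in>UNIV. pvar j * hom n (p j))"
proof -
  let ?F = "tens (hom (Suc n) q)"
  have F: "?F \<in> sym_pow (Suc n)" by (rule hom_tens_sym_pow)
  have "(\<lambda>xs. ?F (j # xs)) \<in> sym_pow n" for j
    unfolding sym_pow_def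
  proof (intro CollectI conjI allI impI)
    show "?F (j # xs) = 0" if "length xs \<noteq> n" for xs
      using that by (intro sym_pow_length[OF F]) simp
    show "?F (j # xs) = ?F (j # ys)" if "mset xs = mset ys" for xs ys
      using that by (intro sym_pow_mset[OF F]) simp
  qed
  then have "\<forall>j. \<exists>p. (\<lambda>xs. ?F (j # xs)) = tens (hom n p)"
    using sym_pow_iff[of _ n] by auto
  then obtain p where p: "\<And>j. (\<lambda>xs. ?F (j # xs)) = tens (hom n (p j))" by metis
  have "?F xs = tens (\<Sum>j\<in>UNIV. pvar j * hom n (p j)) xs" for xs
  proof -
    have "?F xs = (\<Sum>j\<in>UNIV. sym_prod (axis j 1) (tens (hom n (p j))) xs)"
      by (subst slice_decomposition[OF F]) (simp only: p)
    also have "\<dots> = (\<Sum>j\<in>UNIV. tens (pvar j * hom n (p j)) xs)"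
      by (simp add: sym_prod_tens)
    also have "\<dots> = (\<Sum>j\<in>UNIV. tens (pvar j * hom n (p j))) xs"
      by (rule sum_apply[symmetric])
    finally show ?thesis by (simp add: tens_sum)
  qed
  then have "?F = tens (\<Sum>j\<in>UNIV. pvar j * hom n (p j))" by blast
  then have "hom (Suc n) q = (\<Sum>j\<in>UNIV. pvar j * hom n (p j))" by simp
  with p show thesis by (rule that)
qed

text \<open>\<open>ip\<close> is recursive in slices. Those of a polynomial reassemble it by
  \<open>tens_slices\<close>, and \<open>form_kernel_poly\<close> performs the recursion step on
  each pair of slices; in degree 0, \<open>P\<close> fixes the constants and the state is
  normalized.\<close>

lemma ip_kernel: "ip kernel n (tens (hom n q)) (tens (hom n r)) = form (hom n q) (hom n r)"
proof (induction n arbitrary: q r)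
  case 0
  have const: "hom 0 q = cst (Poly_Mapping.lookup q 0)" for q :: "'d mpoly"
  proof (rule poly_mapping_eqI)
    fix m :: "'d \<Rightarrow>\<^sub>0 nat"
    have "mdeg m = 0 \<longleftrightarrow> m = 0" by (auto simp: mdeg_def intro!: poly_mapping_eqI)
    then show "Poly_Mapping.lookup (hom 0 q) m = Poly_Mapping.lookup (cst (Poly_Mapping.lookup q 0)) m"
      by (auto simp: lookup_single when_def)
  qed
  have P: "P (cst c) = cst c" for c
    using plinear_scale[OF P_linear, of c 1] by (simp add: P_one)
  have t: "tens (cst c :: 'd mpoly) [] = c" for c
  proof -
    have "tens (cst c :: 'd mpoly) = cscale c vacuum" using tens_scale[of c "1 :: 'd mpoly"] by (simp add: tens_one)
    then show ?thesis by (simp add: cscale_def vacuum_def)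
  qed
  have "pstar (cst c :: 'd mpoly) = cst (cnj c)" for c
    using pstar_scale[of c 1] by simp
  then show ?case using phi_scale[of _ 1]
    by (simp add: const form_def P t mult_single phi_one)
next
  case (Suc n)
  obtain p where p: "\<And>j. (\<lambda>xs. tens (hom (Suc n) q) (j # xs)) = tens (hom n (p j))"
    "hom (Suc n) q = (\<Sum>j\<in>UNIV. pvar j * hom n (p j))" by (rule tens_slices) blast
  obtain s where s: "\<And>j. (\<lambda>xs. tens (hom (Suc n) r) (j # xs)) = tens (hom n (s j))"
    "hom (Suc n) r = (\<Sum>j\<in>UNIV. pvar j * hom n (s j))" by (rule tens_slices) blast
  have "ip kernel n (tens (hom n (p j))) (tens (kernel_poly n (axis j 1) (axis k 1) (hom n (s k)))) =
      form (pvar j * hom n (p j)) (pvar k * hom n (s k))" for j k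
    using Suc[of "p j" "kernel_poly n (axis j 1) (axis k 1) (hom n (s k))"]
      form_kernel_poly[of "axis j 1" n "p j" "axis k 1" "s k"] by simp
  then have "ip kernel (Suc n) (tens (hom (Suc n) q)) (tens (hom (Suc n) r)) =
      (\<Sum>j\<in>UNIV. \<Sum>k\<in>UNIV. form (pvar j * hom n (p j)) (pvar k * hom n (s k)))"
    by (simp add: p(1) s(1))
  also have "\<dots> = form (hom (Suc n) q) (hom (Suc n) r)"
    by (simp only: p(2) s(2) form.sum_left, simp only: form.sum_right)
  finally show ?case .
qed

lemma psp_kernel: "pre_scalar_product (sym_pow n) (ip kernel n)"
  unfolding pre_scalar_product_def
proof (intro conjI ballI allI)
  fix F :: "'d tensor" assume "F \<in> sym_pow n"
  then obtain f where F: "F = tens (hom n f)" using sym_pow_iff[of F n] by auto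
  show "ip kernel n F F \<in> \<real>\<^sub>\<ge>\<^sub>0" by (simp add: F ip_kernel form.pos)
  fix G :: "'d tensor" assume "G \<in> sym_pow n"
  then obtain g where G: "G = tens (hom n g)" using sym_pow_iff[of G n] by auto
  show "ip kernel n G F = cnj (ip kernel n F G)"
    unfolding F G ip_kernel by (rule form.herm)
  show "ip kernel n F (cscale c G) = c * ip kernel n F G" for c
  proof -
    have "cscale c G = tens (hom n (cst c * g))"
      by (simp add: G tens_scale plinear_scale[OF plinear_restr])
    then have "ip kernel n F (cscale c G) = form (hom n f) (hom n (cst c * g))"
      by (simp only: F ip_kernel)
    then show ?thesis by (simp only: F G ip_kernel plinear_scale[OF plinear_restr] form.scale)
  qed
  fix H :: "'d tensor" assume "H \<in> sym_pow n"
  then obtain h where H: "H = tens (hom n h)" using sym_pow_iff[of H n] by auto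
  have "G + H = tens (hom n (g + h))"
    by (simp add: G H tens_add plinear_add[OF plinear_restr])
  then have "ip kernel n F (G + H) = form (hom n f) (hom n (g + h))"
    by (simp only: F ip_kernel)
  then show "ip kernel n F (G + H) = ip kernel n F G + ip kernel n F H"
    by (simp only: F G H ip_kernel plinear_add[OF plinear_restr] form.add)
qed

lemma kernel_identity:
  assumes "F \<in> sym_pow n" "G \<in> sym_pow n"
  shows "ip kernel (Suc n) (sym_prod u F) (sym_prod v G) = ip kernel n F (kernel (Suc n) u v G)"
proof -
  obtain q r where F: "F = tens (hom n q)" and G: "G = tens (hom n r)"
    using assms sym_pow_iff[of F n] sym_pow_iff[of G n] by auto
  have "ip kernel (Suc n) (sym_prod u F) (sym_prod v G) =
      form (lin_poly u * hom n q) (lin_poly v * hom n r)"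
    using ip_kernel[of "Suc n" "lin_poly u * q" "lin_poly v * r"]
    by (simp add: F G sym_prod_tens hom_lin_poly_mult)
  also have "\<dots> = form (hom n q) (kernel_poly n u v (hom n r))" by (rule form_kernel_poly)
  also have "\<dots> = ip kernel n F (kernel (Suc n) u v G)"
    using ip_kernel[of n q "kernel_poly n u v (hom n r)"] by (simp add: F G)
  finally show ?thesis .
qed

lemma kernel_linear: "linear_oper (sym_pow n) (kernel (Suc n) u v)"
  by (rule linear_oper_sym_powI[OF kernel_poly_linear[of n u v]]) simp

text \<open>Read one degree higher through \<open>kernel_identity\<close>, the claim is the
  Hermitian symmetry of the product there.\<close>

lemma kernel_adjoint: "is_adjoint (sym_pow n) (ip kernel n) (kernel (Suc n) u v) (kernel (Suc n) v u)"
  unfolding is_adjoint_def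
proof (intro conjI ballI kernel_linear)
  fix F G :: "'d tensor" assume FG: "F \<in> sym_pow n" "G \<in> sym_pow n"
  have mem: "kernel (Suc n) u v F \<in> sym_pow n"
    using kernel_linear FG(1) by (auto simp: linear_oper_def)
  have prod: "sym_prod w H \<in> sym_pow (Suc n)" if H: "H \<in> sym_pow n" for w and H :: "'d tensor"
  proof -
    obtain q where "H = tens (hom n q)" using H sym_pow_iff[of H n] by auto
    then show ?thesis
      by (simp add: sym_prod_tens hom_lin_poly_mult[symmetric] hom_tens_sym_pow)
  qed
  have "ip kernel n (kernel (Suc n) u v F) G = cnj (ip kernel n G (kernel (Suc n) u v F))"
    by (rule pre_scalar_productD(3)[OF psp_kernel FG(2) mem])
  also have "\<dots> = cnj (ip kernel (Suc n) (sym_prod u G) (sym_prod v F))"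
    by (simp only: kernel_identity[OF FG(2,1)])
  also have "\<dots> = ip kernel (Suc n) (sym_prod v F) (sym_prod u G)"
    by (rule pre_scalar_productD(3)[OF psp_kernel prod[OF FG(2)] prod[OF FG(1)], symmetric])
  also have "\<dots> = ip kernel n F (kernel (Suc n) v u G)" by (rule kernel_identity[OF FG])
  finally show "ip kernel n (kernel (Suc n) u v F) G = ip kernel n F (kernel (Suc n) v u G)" .
qed

lemma pd_kernel_kernel: "pd_kernel (sym_pow n) (ip kernel n) (kernel (Suc n))"
  unfolding pd_kernel_def
proof (intro conjI allI ballI impI)
  show "kernel (Suc n) u v \<in> La (sym_pow n) (ip kernel n)" for u v
    by (rule La_if_is_adjoint[OF psp_kernel kernel_linear kernel_adjoint])
next
  fix u u' v v' :: "(complex, 'd) vec" and c and h :: "'d tensor" assume "h \<in> sym_pow n"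
  then obtain q where h: "h = tens (hom n q)" using sym_pow_iff[of h n] by auto
  show "kernel (Suc n) (u + u') v h = kernel (Suc n) u v h + kernel (Suc n) u' v h"
    by (simp add: h kernel_poly_def tens_add[symmetric] plinear_add[OF plinear_restr, symmetric]
        single_add distrib_right sum.distrib)
  show "kernel (Suc n) (c *s u) v h = cscale (cnj c) (kernel (Suc n) u v h)"
    by (simp add: h kernel_poly_def tens_scale[symmetric] plinear_scale[OF plinear_restr, symmetric]
        sum_distrib_left cst_mult_cst)
  show "kernel (Suc n) u (v + v') h = kernel (Suc n) u v h + kernel (Suc n) u v' h"
    by (simp add: h kernel_poly_def tens_add[symmetric] plinear_add[OF plinear_restr, symmetric]
        lin_poly_add distrib_right distrib_left sum.distrib plinear_add[OF plinear_mult_op])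
  show "kernel (Suc n) u (c *s v) h = cscale c (kernel (Suc n) u v h)"
    by (simp add: h kernel_poly_def tens_scale[symmetric] plinear_scale[OF plinear_restr, symmetric]
        lin_poly_scale mult.assoc plinear_scale[OF plinear_mult_op] mult.left_commute[of "cst _" "cst c"]
        sum_distrib_left)
next
  fix I :: "(complex, 'd) vec set" and b bs :: "(complex, 'd) vec \<Rightarrow> 'd list oper" and h :: "'d tensor"
  assume *: "finite I \<and> (\<forall>s\<in>I. b s \<in> La (sym_pow n) (ip kernel n) \<and>
      is_adjoint (sym_pow n) (ip kernel n) (b s) (bs s))" and h: "h \<in> sym_pow n"
  have b: "b s h \<in> sym_pow n" if "s \<in> I" for s
    using * that h by (auto simp: La_def linear_oper_def)
  then have "\<forall>s\<in>I. \<exists>q. b s h = tens (hom n q)" using sym_pow_iff[of _ n] by blast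
  then obtain \<beta> where \<beta>: "\<And>s. s \<in> I \<Longrightarrow> b s h = tens (hom n (\<beta> s))" by metis
  have K: "kernel (Suc n) s t (b t h) \<in> sym_pow n" if "t \<in> I" for s t
    using kernel_linear[of n s t] b[OF that] by (auto simp: linear_oper_def)
  have mem: "bs s (kernel (Suc n) s t (b t h)) \<in> sym_pow n" if "s \<in> I" "t \<in> I" for s t
    using * that K[OF that(2)] by (auto simp: is_adjoint_def linear_oper_def)
  \<comment> \<open>Membership is proved along with additivity, because the form is known to be
    additive on \<open>sym_pow n\<close> only.\<close>
  have sum: "ip kernel n h (sum G J) = (\<Sum>i\<in>J. ip kernel n h (G i)) \<and> sum G J \<in> sym_pow n"
    if "\<And>i. i \<in> J \<Longrightarrow> G i \<in> sym_pow n" "finite J" for G and J :: "(complex, 'd) vec set"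
    using that(2,1)
  proof (induction J rule: finite_induct)
    case empty
    have "ip kernel n h 0 = 0"
      using h sym_pow_iff[of h n] ip_kernel[of n _ 0] by (auto simp: plinear_zero[OF plinear_restr])
    moreover have "0 \<in> sym_pow n" by (simp add: sym_pow_def)
    ultimately show ?case unfolding sum.empty by blast
  next
    case (insert i J)
    then have i: "G i \<in> sym_pow n" "sum G J \<in> sym_pow n" by auto
    have "ip kernel n h (sum G J) = (\<Sum>i\<in>J. ip kernel n h (G i))" using insert by blast
    then have "ip kernel n h (G i + sum G J) = ip kernel n h (G i) + (\<Sum>i\<in>J. ip kernel n h (G i))"
      by (simp only: pre_scalar_productD(1)[OF psp_kernel h i])
    then show ?case
      unfolding sum.insert[OF insert.hyps] using sym_pow_add[OF i] by blast
  qed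
  have "ip kernel n h (\<Sum>s\<in>I. \<Sum>t\<in>I. bs s (kernel (Suc n) s t (b t h))) =
      (\<Sum>s\<in>I. \<Sum>t\<in>I. ip kernel n h (bs s (kernel (Suc n) s t (b t h))))"
    using sum mem * by simp
  also have "\<dots> = (\<Sum>s\<in>I. \<Sum>t\<in>I. ip kernel n (b s h) (kernel (Suc n) s t (b t h)))"
    by (intro sum.cong refl) (use * h K in \<open>auto simp: is_adjoint_def\<close>)
  also have "\<dots> = (\<Sum>s\<in>I. \<Sum>t\<in>I. form (lin_poly s * hom n (\<beta> s)) (lin_poly t * hom n (\<beta> t)))"
  proof (intro sum.cong refl)
    fix s t assume "s \<in> I" "t \<in> I"
    then show "ip kernel n (b s h) (kernel (Suc n) s t (b t h)) =
        form (lin_poly s * hom n (\<beta> s)) (lin_poly t * hom n (\<beta> t))"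
      using ip_kernel[of n "\<beta> s" "kernel_poly n s t (hom n (\<beta> t))"] by (simp add: \<beta> form_kernel_poly)
  qed
  \<comment> \<open>The double sum is the norm square of a single vector of degree
    \<open>Suc n\<close>, the sum of the symmetric products of \<open>s\<close> with
    \<open>b s h\<close>; this is the positivity of the kernel.\<close>
  also have "\<dots> = form (\<Sum>s\<in>I. lin_poly s * hom n (\<beta> s)) (\<Sum>t\<in>I. lin_poly t * hom n (\<beta> t))"
    by (simp only: form.sum_left, simp only: form.sum_right)
  finally show "ip kernel n h (\<Sum>s\<in>I. \<Sum>t\<in>I. bs s (kernel (Suc n) s t (b t h))) \<in> \<real>\<^sub>\<ge>\<^sub>0"
    by (simp only: form.pos)
qed

lemma fock_kernel_kernel: "fock_kernel kernel"
  by (simp add: fock_kernel_def psp_kernel pd_kernel_kernel kernel_identity del: ip.simps kernel_Suc)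

sublocale fock: fock_forms kernel
  by unfold_locales (rule psp_kernel)

lemma fform_eq_form: "fock.fform q r = form q r"
proof -
  obtain N where N: "q \<in> deg_less N" using deg_less_ex by blast
  have "fock.fform q r = (\<Sum>n<N. form (hom n q) r)"
    by (simp add: fock.fform_sum[OF N] ip_kernel form_hom[symmetric])
  also have "\<dots> = form q r"
    by (subst (2) sum_hom[OF N]) (rule form.sum_left[symmetric])
  finally show ?thesis .
qed

lemma a0_linear: "linear_oper (sym_pow n) (a0 j n)"
  by (rule linear_oper_sym_powI[OF plinear_mult_op[of j]]) (simp add: a0_def)

lemma a0_self_adjoint: "self_adjoint (sym_pow n) (ip kernel n) (a0 j n)"
proof -
  have "is_adjoint (sym_pow n) (ip kernel n) (a0 j n) (a0 j n)"
    unfolding is_adjoint_def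
  proof (intro conjI ballI a0_linear)
    fix F G :: "'d tensor" assume "F \<in> sym_pow n" "G \<in> sym_pow n"
    then obtain q r where F: "F = tens (hom n q)" and G: "G = tens (hom n r)"
      using sym_pow_iff[of F n] sym_pow_iff[of G n] by auto
    have "form (hom n (mult_op j (hom n q))) (hom n r) = form (mult_op j (hom n q)) (hom n r)"
      by (rule form_hom'[symmetric])
    also have "\<dots> = form (hom n q) (mult_op j (hom n r))" by (rule form_mult_op)
    also have "\<dots> = form (hom n q) (hom n (mult_op j (hom n r)))" by (rule form_hom)
    finally show "ip kernel n (a0 j n F) G = ip kernel n F (a0 j n G)"
      by (simp add: F G a0_def ip_kernel)
  qed
  with La_if_is_adjoint[OF psp_kernel a0_linear] show ?thesis by (simp add: self_adjoint_def)
qed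

section \<open>The annihilators of a state\<close>

abbreviation "pa0 \<equiv> \<lambda>j. pull (oper_sum (a0 j))"

lemmas tens_pa0 = tens_pull[OF linear_oper_sum[OF a0_linear]]
lemmas pa0_linear = plinear_pull[OF linear_oper_sum[OF a0_linear]]

lemma hom_pa0: "hom n (pa0 j q) = hom n (mult_op j (hom n q))"
proof -
  have "tens (hom n (pa0 j q)) = a0 j n (tens (hom n q))"
    using hom_part_oper_sum[where A = "a0 j" and n = n, OF a0_linear tens_fock, of q]
    by (simp add: hom_part_tens[symmetric] tens_pa0)
  then show ?thesis by (simp add: a0_def)
qed

lemma pa0_hom: "pa0 j (hom n q) = hom n (mult_op j (hom n q))"
  by (rule hom_eqI) (simp add: hom_pa0 plinear_zero[OF plinear_mult_op] plinear_zero[OF plinear_restr])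

text \<open>
  On degree \<open>n\<close> this operator may have components of degree below \<open>n - 1\<close>. They are null vectors, and
  keeping them makes the operators \<open>X_hat a0 am j\<close> exactly conjugate to multiplication by the
  variables, so that they commute exactly and not only modulo null vectors.
\<close>

definition am_poly :: "'d \<Rightarrow> 'd mpoly \<Rightarrow> 'd mpoly" where
  "am_poly j q = mult_op j q - pvar j * q - pa0 j q"

definition am :: "'d \<Rightarrow> 'd list oper" where
  "am j F = tens (am_poly j (inv tens F))"

lemma am_tens [simp]: "am j (tens q) = tens (am_poly j q)"
  by (simp add: am_def)

lemma am_poly_linear: "plinear (am_poly j)"
proof -
  have "am_poly j (q + r) = am_poly j q + am_poly j r" for q r
    by (simp add: am_poly_def plinear_add[OF pa0_linear] plinear_add[OF plinear_mult_op] distrib_left)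
  moreover have "am_poly j (cst c * q) = cst c * am_poly j q" for c q
    by (simp add: am_poly_def plinear_scale[OF pa0_linear] plinear_scale[OF plinear_mult_op]
        right_diff_distrib mult.left_commute[of "pvar j"])
  ultimately show ?thesis by (simp add: plinear_def)
qed

text \<open>Without the creator, \<open>mult_op\<close> no longer raises the degree;
  \<open>pa0\<close> then removes exactly the component of degree \<open>n\<close>. For
  \<open>n = 0\<close> nothing is left, so the vacuum is annihilated exactly.\<close>

lemma am_poly_hom: "am_poly j (hom n q) \<in> deg_less n"
proof -
  let ?v = "mult_op j (hom n q) - pvar j * hom n q"
  have "hom n ?v = hom n (mult_op j (hom n q))"
  proof -
    have "hom n (pvar j * hom n q) = hom n (hom (Suc n) (pvar j * q))" by (simp add: hom_pvar_mult)
    then have "hom n (pvar j * hom n q) = 0" by (simp add: plinear_zero[OF plinear_restr])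
    then show ?thesis by (simp add: plinear_diff[OF plinear_restr])
  qed
  then show ?thesis using hom_Suc_deg_less[OF mult_op_top, of j n q]
    by (simp add: am_poly_def pa0_hom)
qed

text \<open>Checked on degrees \<open>m\<close> and \<open>n\<close>. For \<open>m < n\<close> the
  creator and \<open>pa0\<close> contribute nothing on the right, so the symmetry of
  \<open>mult_op\<close> and \<open>mult_op_top\<close> apply. Otherwise both sides vanish:
  \<open>Suc m\<close> exceeds \<open>n\<close>, and the annihilator ends below
  \<open>n\<close>.\<close>

lemma form_am_poly: "form (pvar j * q) r = form q (am_poly j r)"
proof -
  have hom: "form (pvar j * hom m s) (hom n t) = form (hom m s) (am_poly j (hom n t))" for m n s t
  proof (cases "m < n")
    case False
    then have "form (hom m s) (am_poly j (hom n t)) = 0"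
      by (intro form_lower' deg_less_mono[OF am_poly_hom]) simp
    moreover have "form (hom (Suc m) (pvar j * s)) (hom n t) = 0"
      by (rule form_hom_orth) (use False in simp)
    ultimately show ?thesis by (simp add: hom_pvar_mult)
  next
    case True
    have "form (hom m s) (hom (Suc n) (pvar j * t)) = 0" "form (hom m s) (pa0 j (hom n t)) = 0"
      unfolding pa0_hom by (rule form_hom_orth, use True in simp)+
    then have "form (hom m s) (am_poly j (hom n t)) = form (mult_op j (hom m s)) (hom n t)"
      by (simp add: am_poly_def form.diff form_mult_op hom_pvar_mult)
    moreover have "form (mult_op j (hom m s) - pvar j * hom m s) (hom n t) = 0"
      using True by (intro form_lower deg_less_mono[OF mult_op_top]) simp
    ultimately show ?thesis by (simp add: form.diff_left)
  qed
  obtain M N where "q \<in> deg_less M" "r \<in> deg_less N" using deg_less_ex by meson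
  then have q: "q = (\<Sum>k<M. hom k q)" and r: "r = (\<Sum>k<N. hom k r)"
    using sum_hom by blast+
  have "form (pvar j * (\<Sum>k<M. hom k q)) (\<Sum>k<N. hom k r) =
      form (\<Sum>k<M. hom k q) (am_poly j (\<Sum>k<N. hom k r))"
    by (simp add: sum_distrib_left form.sum_left form.sum_right plinear_sum[OF am_poly_linear] hom)
  then show ?thesis by (simp only: q[symmetric] r[symmetric])
qed

lemma am_linear: "linear_oper fock (am j)"
  unfolding linear_oper_def
proof (intro conjI ballI allI)
  fix F :: "'d tensor" assume "F \<in> fock"
  then obtain q where F: "F = tens q" using fock_iff by blast
  show "am j F \<in> fock" by (simp add: F tens_fock)
  show "am j (cscale c F) = cscale c (am j F)" for c
    by (simp add: F tens_scale[symmetric] plinear_scale[OF am_poly_linear])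
  fix G :: "'d tensor" assume "G \<in> fock"
  then obtain r where G: "G = tens r" using fock_iff by blast
  show "am j (F + G) = am j F + am j G"
    by (simp add: F G tens_add[symmetric] plinear_add[OF am_poly_linear])
qed

lemma annihilators_am: "annihilators kernel am"
  unfolding annihilators_def is_adjoint_def
proof (intro allI conjI ballI am_linear)
  fix j and F G :: "'d tensor" assume "F \<in> fock" "G \<in> fock"
  then obtain q r where "F = tens q" "G = tens r" using fock_iff[of F] fock_iff[of G] by auto
  then show "fock_ip kernel (creator (axis j 1) F) G = fock_ip kernel F (am j G)"
    using form_am_poly[of j q r]
    by (simp add: creator_tens fock.fform_def[symmetric] fform_eq_form)
next
  fix j
  have "hom 0 1 = (1 :: 'd mpoly)" using hom_monom[of 0 0] by simp
  then have "am_poly j 1 = 0" using am_poly_hom[of j 0 1] deg_less_0D by simp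
  then show "am j vacuum = 0" by (simp add: tens_one[symmetric])
qed

section \<open>Cyclicity, reality and moments for the pair of a state\<close>

sublocale ops: fock_operators kernel a0 am
  by unfold_locales (rule fock_kernel_kernel a0_self_adjoint annihilators_am)+

lemma X_hat_tens: "X_hat a0 am j (tens q) = tens (mult_op j q)"
  by (simp add: X_hat_def creator_tens tens_pa0[symmetric] tens_add[symmetric] am_poly_def)

lemma X_eq_mult_op: "ops.X j q = mult_op j q"
  using ops.X_hat_tens[of j q] X_hat_tens[of j q] by simp

text \<open>The operators are multiplications conjugated by \<open>P\<close>, and \<open>P\<close>
  fixes 1; evaluation at the vacuum is therefore the inverse of \<open>P\<close>. Its surjectivity
  gives cyclicity.\<close>

lemma inv_P_orbit:
  assumes "0 \<in> S" "\<And>m. Poly_Mapping.lookup q m \<in> S"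
  shows "tens (inv P q) \<in> orbit_of S (X_hat a0 am)"
proof (rule tens_mem_orbit[OF plinear_inv_P _ _ assms])
  show "inv P 1 = 1" using inv_P[of 1] by (simp only: P_one)
  show "tens (inv P (pvar j * q)) = X_hat a0 am j (tens (inv P q))" for j q
    by (simp add: X_hat_tens mult_op_def)
qed

lemma orbit_UNIV: "orbit_of UNIV (X_hat a0 am) = fock"
proof
  show "orbit_of UNIV (X_hat a0 am) \<subseteq> fock"
  proof
    fix F assume "F \<in> orbit_of UNIV (X_hat a0 am)"
    then obtain A where A: "A \<in> gen_algebra UNIV (X_hat a0 am)" "F = A vacuum"
      by (auto simp: orbit_of_def)
    have "A vacuum \<in> range tens"
    proof (rule gen_algebra_preserves[OF A(1)])
      show "vacuum \<in> range (tens :: 'd mpoly \<Rightarrow> _)" by (simp flip: tens_one)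
    qed (auto simp: tens_add[symmetric] tens_scale[symmetric] X_hat_tens)
    then show "F \<in> fock" using A(2) tens_fock by auto
  qed
  show "fock \<subseteq> orbit_of UNIV (X_hat a0 am)"
  proof
    fix F :: "'d tensor" assume "F \<in> fock"
    then obtain q where "F = tens q" using fock_iff by blast
    then show "F \<in> orbit_of UNIV (X_hat a0 am)" using inv_P_orbit[of UNIV "P q"] by simp
  qed
qed

text \<open>Since \<open>P\<close> commutes with conjugation, the real orbit is just the real
  polynomials, for which stability under the three parts is plain.\<close>

lemma orbit_Reals: "orbit_of \<real> (X_hat a0 am) = tens ` {q. pstar q = q}"
proof
  show "orbit_of \<real> (X_hat a0 am) \<subseteq> tens ` {q. pstar q = q}"
  proof
    fix F assume "F \<in> orbit_of \<real> (X_hat a0 am)"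
    then obtain A where A: "A \<in> gen_algebra \<real> (X_hat a0 am)" "F = A vacuum"
      by (auto simp: orbit_of_def)
    have "A vacuum \<in> tens ` {q. pstar q = q}"
    proof (rule gen_algebra_preserves[OF A(1)])
      show "vacuum \<in> tens ` {q :: 'd mpoly. pstar q = q}" by (rule image_eqI[of _ _ 1]) (simp_all add: tens_one)
    qed (auto simp: tens_add[symmetric] tens_scale[symmetric] X_hat_tens pstar_add pstar_scale
        mult_op_pstar[symmetric] Reals_cnj_iff)
    then show "F \<in> tens ` {q. pstar q = q}" using A(2) by simp
  qed
  show "tens ` {q. pstar q = q} \<subseteq> orbit_of \<real> (X_hat a0 am)"
  proof (rule image_subsetI)
    fix q :: "'d mpoly" assume "q \<in> {q. pstar q = q}"
    then have "real_poly (P q)" by (simp add: real_poly_iff_pstar P_real[symmetric])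
    then show "tens q \<in> orbit_of \<real> (X_hat a0 am)"
      using inv_P_orbit[of \<real> "P q"] by (simp add: real_poly_def)
  qed
qed

lemma pstar_hom: "pstar (hom n q) = hom n (pstar q)"
  by (rule poly_mapping_eqI) simp

lemma pa0_pstar: "pstar (pa0 j q) = pa0 j (pstar q)"
  by (rule hom_eqI) (simp add: pstar_hom[symmetric] hom_pa0 mult_op_pstar)

lemma three_diagonal_am: "three_diagonal kernel a0 am"
  unfolding three_diagonal_def Let_def
proof (intro conjI allI ballI)
  fix j k and F :: "'d tensor" assume "F \<in> fock"
  then obtain q where "F = tens q" using fock_iff by blast
  then show "X_hat a0 am j (X_hat a0 am k F) = X_hat a0 am k (X_hat a0 am j F)"
    by (simp add: X_hat_tens mult_op_commute)
next
  fix F G assume "F \<in> orbit_of \<real> (X_hat a0 am)" "G \<in> orbit_of \<real> (X_hat a0 am)"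
  then obtain q r where qr: "F = tens q" "pstar q = q" "G = tens r" "pstar r = r"
    by (auto simp: orbit_Reals)
  have "\<phi> (pstar (P q) * P r) \<in> \<real>"
    by (rule phi_real) (simp add: real_poly_iff_pstar pstar_mult P_real[symmetric] qr)
  then show "fock_ip kernel F G \<in> \<real>"
    using fform_eq_form[of q r] by (simp add: qr fock.fform_def form_def)
next
  fix j F assume "F \<in> orbit_of \<real> (X_hat a0 am)"
  then obtain q where q: "F = tens q" "pstar q = q" by (auto simp: orbit_Reals)
  show "creator (axis j 1) F \<in> orbit_of \<real> (X_hat a0 am)"
    by (simp add: orbit_Reals q creator_tens image_iff pstar_pvar_mult)
  show "oper_sum (a0 j) F \<in> orbit_of \<real> (X_hat a0 am)"
    by (simp add: orbit_Reals q tens_pa0[symmetric] image_iff pa0_pstar)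
  show "am j F \<in> orbit_of \<real> (X_hat a0 am)"
    by (simp add: orbit_Reals q image_iff am_poly_def pstar_diff pstar_pvar_mult pa0_pstar
        mult_op_pstar[symmetric])
qed (rule orbit_UNIV)

lemma induces_kernel: "induces_3_diagonal kernel a0"
  unfolding induces_3_diagonal_def
  using fock_kernel_kernel a0_self_adjoint annihilators_am three_diagonal_am by blast

lemma same_moments_kernel: "same_moments \<phi> kernel a0"
proof -
  have diag: "three_diagonal_fock kernel a0 am"
    by unfold_locales (rule three_diagonal_am)
  then interpret diag: three_diagonal_fock kernel a0 am .
  show ?thesis
  proof (rule same_moments_if[OF diag])
    fix m
    \<comment> \<open>For this pair \<open>T\<close> inverts \<open>P\<close>, so the form of 1 with
      \<open>T (monom m)\<close> gives back the value of the state at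
      \<open>monom m\<close>.\<close>
    have "diag.T (monom m) = inv P (monom m)"
    proof (induction m rule: exponent_induct)
      case zero
      then show ?case using inv_P[of 1] by (simp add: diag.T_one P_one)
    next
      case (single j m)
      then show ?case by (simp add: monom_Cons diag.T_pvar_mult X_eq_mult_op mult_op_def)
    qed
    then show "\<phi> (monom m) = fock.fform 1 (diag.T (monom m))"
      by (simp add: fform_eq_form form_def P_one)
  qed
qed

end

theorem theorem5p4:
  shows "(\<forall>\<phi> :: 'd::{finite,linorder} mpoly \<Rightarrow> complex. is_state \<phi> \<longrightarrow>
            (\<exists>\<Omega> a0. induces_3_diagonal \<Omega> a0 \<and> same_moments \<phi> \<Omega> a0 \<and>
               (\<forall>\<Omega>' a0'. induces_3_diagonal \<Omega>' a0' \<and> same_moments \<phi> \<Omega>' a0' \<longrightarrow>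
                  pair_eq \<Omega> a0 \<Omega>' a0'))) \<and>
         (\<forall>(\<Omega> :: 'd kernel_seq) a0. induces_3_diagonal \<Omega> a0 \<longrightarrow>
            (\<exists>!\<phi>. is_state \<phi> \<and> same_moments \<phi> \<Omega> a0))"
proof (intro conjI allI impI)
  fix \<phi> :: "'d mpoly \<Rightarrow> complex" assume \<phi>: "is_state \<phi>"
  then obtain P where "orth_poly \<phi> P" using ex_orth_poly by blast
  then interpret state_pair \<phi> P by (simp add: state_pair_def)
  show "\<exists>\<Omega> a0. induces_3_diagonal \<Omega> a0 \<and> same_moments \<phi> \<Omega> a0 \<and>
      (\<forall>\<Omega>' a0'. induces_3_diagonal \<Omega>' a0' \<and> same_moments \<phi> \<Omega>' a0' \<longrightarrow> pair_eq \<Omega> a0 \<Omega>' a0')"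
    using induces_kernel same_moments_kernel pair_eq_if_same_moments[OF \<phi>] by blast
qed (rule ex1_state)

end
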